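(* Let $M_{1}\geq0$ and $M_{2}>0$ be constants, let $g:\overline{\mathbb{D}}\to\mathbb{C}$ be continuous with $\|g\|_{\infty}\leq M_{1}$, and let $f\in\mathcal{F}_{g}(\overline{\mathbb{D}})$ satisfy $\|f\|_{\infty}\leq M_{2}$. Let $r_{0}\in(0,1)$ satisfy $$\frac{1}{\frac{4}{\pi}M_{2}+\frac{2}{3}M_{1}}-\frac{4M_{2}}{\pi}\,\frac{r_{0}(2-r_{0})}{(1-r_{0})^{2}}-2M_{1}\big[\log(4(1+r_{0}))-\log r_{0}\big](2+r_{0})r_{0}=0.$$ Then $f$ is univalent (injective) in $\mathbb{D}_{r_{0}}$. Moreover, $f(\mathbb{D}_{r_{0}})$ contains a univalent disk $\mathbb{D}_{R_{0}}$ with $$R_{0}\geq\frac{2M_{2}}{\pi}\,\frac{r_{0}^{2}(2-r_{0})}{(1-r_{0})^{2}}.$$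
   Context: $\mathbb{D}_{r}=\{z\in\mathbb{C}:|z|<r\}$, $\mathbb{D}=\mathbb{D}_1$. For $g$ continuous on $\overline{\mathbb{D}}$, $\mathcal{F}_{g}(\overline{\mathbb{D}})$ denotes the class of all complex-valued functions $f$ that are continuous on $\overline{\mathbb{D}}$ and twice continuously differentiable in $\mathbb{D}$, satisfying $\Delta f=g$ in $\mathbb{D}$ and $f(0)=J_{f}(0)-1=0$. Here $\Delta f=f_{xx}+f_{yy}$ for $z=x+iy$, and $J_{f}=|f_{z}|^{2}-|f_{\overline{z}}|^{2}$ is the Jacobian determinant of $f$, with $f_z=\frac12(f_x-if_y)$, $f_{\overline z}=\frac12(f_x+if_y)$. Norms: $\|g\|_{\infty}=\sup_{z\in\mathbb{D}}|g(z)|$, $\|f\|_{\infty}=\sup_{z\in\mathbb{D}}|f(z)|$. That $f(\mathbb{D}_{r_0})$ contains a univalent disk $\mathbb{D}_{R_0}$ means $\mathbb{D}_{R_0}\subseteq f(\mathbb{D}_{r_0})$ and $f$ maps some subdomain of $\mathbb{D}_{r_0}$ injectively onto $\mathbb{D}_{R_0}$. *)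

theory Defs
  imports "HOL-Analysis.Analysis"
begin

definition partial_x :: "(complex \<Rightarrow> complex) \<Rightarrow> complex \<Rightarrow> complex" where
  "partial_x f z = vector_derivative (\<lambda>t::real. f (z + complex_of_real t)) (at 0)"

definition partial_y :: "(complex \<Rightarrow> complex) \<Rightarrow> complex \<Rightarrow> complex" where
  "partial_y f z = vector_derivative (\<lambda>t::real. f (z + \<i> * complex_of_real t)) (at 0)"

(* Differentiability is over the reals and S is meant to be open. Continuity of the two
   partial derivatives is continuity of the (real) derivative. *)
definition C1_on :: "complex set \<Rightarrow> (complex \<Rightarrow> complex) \<Rightarrow> bool" where
  "C1_on S f \<longleftrightarrow> f differentiable_on S \<and> continuous_on S (partial_x f) \<and> continuous_on S (partial_y f)"

definition C2_on :: "complex set \<Rightarrow> (complex \<Rightarrow> complex) \<Rightarrow> bool" where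
  "C2_on S f \<longleftrightarrow> C1_on S f \<and> C1_on S (partial_x f) \<and> C1_on S (partial_y f)"

definition laplacian :: "(complex \<Rightarrow> complex) \<Rightarrow> complex \<Rightarrow> complex" where
  "laplacian f z = partial_x (partial_x f) z + partial_y (partial_y f) z"

definition wirtinger_z :: "(complex \<Rightarrow> complex) \<Rightarrow> complex \<Rightarrow> complex" where
  "wirtinger_z f z = (partial_x f z - \<i> * partial_y f z) / 2"

definition wirtinger_zbar :: "(complex \<Rightarrow> complex) \<Rightarrow> complex \<Rightarrow> complex" where
  "wirtinger_zbar f z = (partial_x f z + \<i> * partial_y f z) / 2"

definition jacobian :: "(complex \<Rightarrow> complex) \<Rightarrow> complex \<Rightarrow> real" where
  "jacobian f z = (cmod (wirtinger_z f z))\<^sup>2 - (cmod (wirtinger_zbar f z))\<^sup>2"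

(* Functions on the closed unit disk are total functions on the complex plane;
   their values outside the closed disk are irrelevant. *)
definition poisson_class :: "(complex \<Rightarrow> complex) \<Rightarrow> (complex \<Rightarrow> complex) set" where
  "poisson_class g = {f. continuous_on (cball 0 1) f \<and> C2_on (ball 0 1) f \<and>
     (\<forall>z\<in>ball 0 1. laplacian f z = g z) \<and> f 0 = 0 \<and> jacobian f 0 - 1 = 0}"

(* A meaningful supremum only for functions bounded on the unit disk,
   e.g. those continuous on its closure. *)
definition disk_sup_norm :: "(complex \<Rightarrow> complex) \<Rightarrow> real" where
  "disk_sup_norm f = (SUP z\<in>ball 0 1. cmod (f z))"

definition contains_univalent_disk :: "(complex \<Rightarrow> complex) \<Rightarrow> real \<Rightarrow> real \<Rightarrow> bool" where
  "contains_univalent_disk f r R \<longleftrightarrow> ball 0 R \<subseteq> f ` ball 0 r \<and>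
     (\<exists>\<Omega>. \<Omega> \<subseteq> ball 0 r \<and> \<Omega> \<noteq> {} \<and> open \<Omega> \<and> connected \<Omega> \<and> bij_betw f \<Omega> (ball 0 R))"

end

theory Submission
  imports Defs
begin


text \<open>
  The boundary values of \<open>f\<close> are uniformly \<open>\<epsilon>\<close>-close on the unit circle to a harmonic polynomial
  \<open>h = A + cnj B\<close>, which replaces the Poisson integral. The coefficients of \<open>h\<close> satisfy
  \<open>|a\<^sub>n| + |b\<^sub>n| \<le> 4 (M\<^sub>2 + \<epsilon>) / \<pi>\<close> for \<open>n \<ge> 1\<close>, because \<open>|cos|\<close> has mean \<open>2 / \<pi>\<close>.

  The remainder \<open>v = f - h\<close> replaces the Green potential. The maximum principle gives
  \<open>|v z| \<le> \<epsilon> + M\<^sub>1 (1 - |z|\<^sup>2) / 4\<close>, and its derivatives are controlled by the Fourier coefficients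
  \<open>C\<^sub>n F (s)\<close> of \<open>F\<close> on the circle of radius \<open>s\<close>, which satisfy
  \<open>(s\<^sup>n C\<^sub>n F)' = 2 s\<^sup>n C\<^sub>n\<^sub>-\<^sub>1 (\<partial>\<^sub>z F)\<close> and \<open>(C\<^sub>1 F / s)' = 2 C\<^sub>2 (\<partial>\<^sub>z\<^sub>b\<^sub>a\<^sub>r F) / s\<close>.
  So \<open>C\<^sub>1 v / s\<close> approximates \<open>\<partial>\<^sub>z v\<close> at the centre with error \<open>O(s)\<close>, while its own gradient grows only
  like \<open>log (1 / s)\<close>; taking \<open>s = |z|\<close> yields the logarithmic modulus of continuity of \<open>\<partial>\<^sub>z v\<close>.

  The equation for \<open>r\<^sub>0\<close> together with \<open>J\<^sub>f(0) = 1\<close> forces \<open>r\<^sub>0 \<le> 1/3\<close>, so these estimates are only needed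
  for \<open>|z| \<le> 1/3\<close>. Letting \<open>\<epsilon> \<rightarrow> 0\<close>, Landau's argument applies: the derivative of \<open>f\<close> stays closer to
  the derivative at 0 than the smallest singular value of the latter, which is at least
  \<open>1 / (4 M\<^sub>2 / \<pi> + 2 M\<^sub>1 / 3)\<close>.
\<close>

section \<open>Wirtinger derivatives and Fourier coefficients on circles\<close>

text \<open>\<open>P\<close> and \<open>Q\<close> are the derivatives of \<open>F\<close> by \<open>z\<close> and by its conjugate.\<close>

definition wirtinger_on :: "complex set \<Rightarrow> (complex \<Rightarrow> complex) \<Rightarrow> (complex \<Rightarrow> complex) \<Rightarrow> (complex \<Rightarrow> complex) \<Rightarrow> bool" where
  "wirtinger_on S F P Q \<longleftrightarrow> (\<forall>z\<in>S. (F has_derivative (\<lambda>h. P z * h + Q z * cnj h)) (at z)) \<and>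
     continuous_on S P \<and> continuous_on S Q"

lemma wirtinger_onD:
  assumes "wirtinger_on S F P Q"
  shows "z \<in> S \<Longrightarrow> (F has_derivative (\<lambda>h. P z * h + Q z * cnj h)) (at z)"
    and "continuous_on S P" "continuous_on S Q"
  using assms by (auto simp: wirtinger_on_def)

lemma wirtinger_on_continuous:
  assumes "wirtinger_on S F P Q"
  shows "continuous_on S F"
  using wirtinger_onD(1)[OF assms] by (meson continuous_at_imp_continuous_on has_derivative_continuous)

lemma wirtinger_on_cong:
  assumes "wirtinger_on S F P Q" "\<And>z. z \<in> S \<Longrightarrow> P z = P' z" "\<And>z. z \<in> S \<Longrightarrow> Q z = Q' z"
  shows "wirtinger_on S F P' Q'"
  using assms unfolding wirtinger_on_def by (simp cong: continuous_on_cong)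

lemma wirtinger_on_diff:
  assumes "wirtinger_on S F P Q" "wirtinger_on S G P' Q'"
  shows "wirtinger_on S (\<lambda>z. F z - G z) (\<lambda>z. P z - P' z) (\<lambda>z. Q z - Q' z)"
  using assms unfolding wirtinger_on_def
  by (auto intro!: derivative_eq_intros continuous_intros simp: algebra_simps)

lemma wirtinger_on_add:
  assumes "wirtinger_on S F P Q" "wirtinger_on S G P' Q'"
  shows "wirtinger_on S (\<lambda>z. F z + G z) (\<lambda>z. P z + P' z) (\<lambda>z. Q z + Q' z)"
  using assms unfolding wirtinger_on_def
  by (auto intro!: derivative_eq_intros continuous_intros simp: algebra_simps)

lemma wirtinger_on_cmult:
  assumes "wirtinger_on S F P Q"
  shows "wirtinger_on S (\<lambda>z. c * F z) (\<lambda>z. c * P z) (\<lambda>z. c * Q z)"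
  using assms unfolding wirtinger_on_def
  by (auto intro!: derivative_eq_intros continuous_intros simp: algebra_simps)

lemma wirtinger_on_cnj:
  assumes "wirtinger_on S F P Q"
  shows "wirtinger_on S (\<lambda>z. cnj (F z)) (\<lambda>z. cnj (Q z)) (\<lambda>z. cnj (P z))"
  using assms unfolding wirtinger_on_def
  by (auto intro!: derivative_eq_intros continuous_intros simp: algebra_simps)

lemma wirtinger_on_poly: "wirtinger_on S (poly p) (poly (pderiv p)) (\<lambda>_. 0)"
  unfolding wirtinger_on_def
  using poly_DERIV[of p] by (auto simp: has_field_derivative_def intro!: continuous_intros)

lemma wirtinger_on_curve:
  assumes "wirtinger_on S F P Q" "\<gamma> x \<in> S" "(\<gamma> has_vector_derivative d) (at x within T)"
  shows "((\<lambda>x. F (\<gamma> x)) has_vector_derivative (P (\<gamma> x) * d + Q (\<gamma> x) * cnj d)) (at x within T)"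
proof -
  have "((\<lambda>x. F (\<gamma> x)) has_derivative (\<lambda>t. P (\<gamma> x) * (t *\<^sub>R d) + Q (\<gamma> x) * cnj (t *\<^sub>R d))) (at x within T)"
    by (rule has_derivative_compose[OF assms(3)[unfolded has_vector_derivative_def] wirtinger_onD(1)[OF assms(1,2)]])
  then show ?thesis
    by (simp add: has_vector_derivative_def algebra_simps)
qed

text \<open>The Fourier coefficient of order \<open>n\<close> on the circle of radius
  \<open>s\<close> about \<open>z\<close>, without the factor \<open>1 / (2 * pi)\<close>; for
  \<open>s = 0\<close> and \<open>n = 0\<close> it is \<open>2 * pi\<close> times the value at the
  centre.\<close>

definition circle_coeff :: "int \<Rightarrow> (complex \<Rightarrow> complex) \<Rightarrow> complex \<Rightarrow> real \<Rightarrow> complex" where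
  "circle_coeff n F z s = integral {0..2*pi} (\<lambda>t. F (z + of_real s * cis t) * cis (- of_int n * t))"

lemma cis_frequency_shift:
  "cis (- of_int (n - 1) * t) = cis t * cis (- of_int n * t)"
  "cis (- of_int (n + 1) * t) = cnj (cis t) * cis (- of_int n * t)"
  by (simp_all add: cis_mult cis_cnj algebra_simps)

lemma circle_in_cball: "\<bar>s\<bar> \<le> \<rho> \<Longrightarrow> z + of_real s * cis t \<in> cball z \<rho>"
  by (simp add: dist_norm norm_mult)

lemma circle_coeff_integrable:
  assumes "continuous_on S F" "cball z s \<subseteq> S" "s \<ge> 0"
  shows "(\<lambda>t. F (z + of_real s * cis t) * cis (- of_int n * t)) integrable_on {a..b}"
proof (rule integrable_continuous_real)
  show "continuous_on {a..b} (\<lambda>t. F (z + of_real s * cis t) * cis (- of_int n * t))"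
    using assms(2,3) circle_in_cball[of s s z]
    by (intro continuous_intros continuous_on_compose2[OF assms(1)]) auto
qed

lemma norm_circle_coeff_le:
  assumes "continuous_on S F" "cball z s \<subseteq> S" "s \<ge> 0" "\<And>w. w \<in> cball z s \<Longrightarrow> cmod (F w) \<le> M"
  shows "cmod (circle_coeff n F z s) \<le> 2 * pi * M"
proof -
  have "cmod (circle_coeff n F z s) \<le> integral {0..2*pi} (\<lambda>t. M)"
    unfolding circle_coeff_def
    using assms circle_in_cball[of s s z]
    by (intro integral_norm_bound_integral circle_coeff_integrable[OF assms(1-3)])
       (auto simp: norm_mult)
  then show ?thesis by (simp add: mult.commute)
qed

text \<open>The radial derivative of \<open>F\<close> at angle \<open>t\<close> is
  \<open>P * cis t + Q * cnj (cis t)\<close>, so differentiation under the integral sign shifts the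
  frequency by one in either direction.\<close>

lemma circle_coeff_has_derivative:
  assumes w: "wirtinger_on S F P Q" and sub: "cball z \<rho> \<subseteq> S" and s: "s \<in> {0..\<rho>}"
  shows "(circle_coeff n F z has_vector_derivative
           (circle_coeff (n - 1) P z s + circle_coeff (n + 1) Q z s)) (at s within {0..\<rho>})"
proof -
  note cont = wirtinger_onD(2,3)[OF w] wirtinger_on_continuous[OF w]
  have inS: "x \<in> {0..\<rho>} \<Longrightarrow> z + of_real x * cis t \<in> S" for x t
    using circle_in_cball[of x \<rho> z t] sub by auto
  have subx: "x \<in> {0..\<rho>} \<Longrightarrow> cball z x \<subseteq> S" for x
    using sub subset_cball by fastforce
  have "((\<lambda>x. integral (cbox 0 (2*pi)) (\<lambda>t. F (z + of_real x * cis t) * cis (- of_int n * t)))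
      has_vector_derivative
      integral (cbox 0 (2*pi)) (\<lambda>t. (P (z + of_real s * cis t) * cis t + Q (z + of_real s * cis t) * cnj (cis t)) * cis (- of_int n * t)))
      (at s within {0..\<rho>})"
  proof (rule leibniz_rule_vector_derivative)
    fix x t :: real assume x: "x \<in> {0..\<rho>}"
    have "((\<lambda>x. z + of_real x * cis t) has_vector_derivative cis t) (at x within {0..\<rho>})"
      by (auto intro!: derivative_eq_intros simp: has_vector_derivative_def scaleR_conv_of_real)
    from wirtinger_on_curve[OF w inS[OF x] this]
    show "((\<lambda>x. F (z + of_real x * cis t) * cis (- of_int n * t)) has_vector_derivative
       (P (z + of_real x * cis t) * cis t + Q (z + of_real x * cis t) * cnj (cis t)) * cis (- of_int n * t))
       (at x within {0..\<rho>})"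
      by (rule has_vector_derivative_mult_left)
  next
    fix x :: real assume x: "x \<in> {0..\<rho>}"
    then show "(\<lambda>t. F (z + of_real x * cis t) * cis (- of_int n * t)) integrable_on cbox 0 (2 * pi)"
      using circle_coeff_integrable[OF cont(3) subx[OF x]] by auto
  next
    show "continuous_on ({0..\<rho>} \<times> cbox 0 (2 * pi))
     (\<lambda>(x, t). (P (z + of_real x * cis t) * cis t + Q (z + of_real x * cis t) * cnj (cis t)) * cis (- of_int n * t))"
      unfolding split_beta using inS
      by (intro continuous_intros continuous_on_compose2[OF cont(1)] continuous_on_compose2[OF cont(2)]) auto
  qed (use s in auto)
  moreover have "integral {0..2*pi} (\<lambda>t. (P (z + of_real s * cis t) * cis t + Q (z + of_real s * cis t) * cnj (cis t)) * cis (- of_int n * t))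
     = circle_coeff (n - 1) P z s + circle_coeff (n + 1) Q z s"
  proof -
    have "0 \<le> s" "cball z s \<subseteq> S"
      using s subx by auto
    note int = circle_coeff_integrable[OF cont(1) this(2,1)] circle_coeff_integrable[OF cont(2) this(2,1)]
    show ?thesis
      unfolding circle_coeff_def integral_add[OF int, symmetric]
      by (intro integral_cong) (simp only: cis_frequency_shift, simp add: algebra_simps)
  qed
  ultimately show ?thesis
    by (simp add: circle_coeff_def[abs_def])
qed

text \<open>Integration by parts in the angle.\<close>

lemma circle_coeff_angular:
  assumes w: "wirtinger_on S F P Q" and sub: "cball z s \<subseteq> S" and s: "0 \<le> s"
  shows "of_real s * (circle_coeff (n - 1) P z s - circle_coeff (n + 1) Q z s) = of_int n * circle_coeff n F z s"
proof -
  note cont = wirtinger_onD(2,3)[OF w] wirtinger_on_continuous[OF w]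
  have inS: "z + of_real s * cis t \<in> S" for t
    using circle_in_cball[of s s z t] sub s by auto
  let ?f = "\<lambda>t. F (z + of_real s * cis t) * cis (- of_int n * t)"
  let ?f' = "\<lambda>t. \<i> * (of_real s * (P (z + of_real s * cis t) * cis (- of_int (n - 1) * t) - Q (z + of_real s * cis t) * cis (- of_int (n + 1) * t))
       - of_int n * (F (z + of_real s * cis t) * cis (- of_int n * t)))"
  have d: "(?f has_vector_derivative ?f' t) (at t within {0..2*pi})" for t
  proof -
    have 1: "((\<lambda>t. z + of_real s * cis t) has_vector_derivative of_real s * (\<i> * cis t)) (at t within {0..2*pi})"
      unfolding has_vector_derivative_def
      by (auto intro!: derivative_eq_intros ext simp: scaleR_conv_of_real)
    have 2: "((\<lambda>t. cis (- of_int n * t)) has_vector_derivative (- of_int n * (\<i> * cis (- of_int n * t)))) (at t within {0..2*pi})"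
      unfolding has_vector_derivative_def
      by (auto intro!: derivative_eq_intros ext simp: scaleR_conv_of_real)
    show ?thesis
      by (rule has_vector_derivative_eq_rhs[OF has_vector_derivative_mult[OF wirtinger_on_curve[OF w inS 1] 2]])
         (simp only: cis_frequency_shift, simp add: algebra_simps)
  qed
  have "(?f' has_integral (?f (2*pi) - ?f 0)) {0..2*pi}"
    by (rule fundamental_theorem_of_calculus[OF _ d]) auto
  moreover have "?f (2*pi) - ?f 0 = 0"
  proof -
    have "cis (- (of_int n * (2 * pi))) = 1"
      using cis_multiple_2pi[of "- of_int n"] by (simp add: mult.commute mult.left_commute)
    then show ?thesis by simp
  qed
  ultimately have "(?f' has_integral 0) {0..2*pi}" by (simp only:)
  moreover have "(?f' has_integral \<i> * (of_real s * (circle_coeff (n - 1) P z s - circle_coeff (n + 1) Q z s) - of_int n * circle_coeff n F z s)) {0..2*pi}"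
    unfolding circle_coeff_def
    by (intro has_integral_mult_right has_integral_diff integrable_integral circle_coeff_integrable[OF cont(1) sub s]
         circle_coeff_integrable[OF cont(2) sub s] circle_coeff_integrable[OF cont(3) sub s])
  ultimately have "\<i> * (of_real s * (circle_coeff (n - 1) P z s - circle_coeff (n + 1) Q z s) - of_int n * circle_coeff n F z s) = 0"
    using has_integral_unique by blast
  then show ?thesis by simp
qed


text \<open>By the angular identity, the term that the product rule adds is \<open>s ^ k\<close>
  times the difference of the two coefficients whose sum is the radial derivative. The
  \<open>Q\<close> terms cancel, which leaves a derivative governed by \<open>P\<close>.\<close>

lemma circle_coeff_power_derivative:
  assumes w: "wirtinger_on S F P Q" and sub: "cball z \<rho> \<subseteq> S" and s: "s \<in> {0..\<rho>}" and k: "k \<ge> 1"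
  shows "((\<lambda>s. of_real s ^ k * circle_coeff (int k) F z s) has_vector_derivative
           2 * of_real s ^ k * circle_coeff (int k - 1) P z s) (at s within {0..\<rho>})"
proof -
  obtain j where j: "k = Suc j" using k by (cases k) auto
  have "cball z s \<subseteq> S" using sub s subset_cball by fastforce
  then have ang: "of_real s * (circle_coeff (int k - 1) P z s - circle_coeff (int k + 1) Q z s)
      = of_int (int k) * circle_coeff (int k) F z s"
    using circle_coeff_angular[OF w] s by auto
  have pow: "((\<lambda>s. of_real s ^ k :: complex) has_vector_derivative of_nat k * of_real s ^ j) (at s within {0..\<rho>})"
    using has_vector_derivative_of_real[OF has_field_derivative_at_within[OF DERIV_pow[of k s]], where 'a = complex]
    by (simp add: j)
  have "of_nat k * of_real s ^ j * circle_coeff (int k) F z s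
      = of_real s ^ k * (circle_coeff (int k - 1) P z s - circle_coeff (int k + 1) Q z s)"
    using arg_cong[OF ang, of "\<lambda>x. of_real s ^ j * x"] by (simp add: j algebra_simps)
  then show ?thesis
    using has_vector_derivative_mult[OF pow circle_coeff_has_derivative[OF w sub s, of "int k"]]
    by (elim has_vector_derivative_eq_rhs) (simp add: algebra_simps)
qed

text \<open>\<open>s ^ k\<close> times the coefficient vanishes at 0, and its derivative at
  \<open>y\<close> has modulus at most \<open>4 * pi * B * y ^ k\<close>; integrating and dividing
  by \<open>s ^ k\<close> produces the factor \<open>s / (k + 1)\<close>.\<close>

lemma norm_circle_coeff_le_radius:
  assumes w: "wirtinger_on S F P Q" and sub: "cball z s \<subseteq> S" and s: "0 \<le> s" and k: "k \<ge> 1"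
    and B: "\<And>w. w \<in> S \<Longrightarrow> cmod (P w) \<le> B"
  shows "cmod (circle_coeff (int k) F z s) \<le> 4 * pi * B * s / (k + 1)"
proof -
  let ?G = "\<lambda>s. of_real s ^ k * circle_coeff (int k) F z s"
  have d: "x \<in> {0..s} \<Longrightarrow> (?G has_vector_derivative 2 * of_real x ^ k * circle_coeff (int k - 1) P z x) (at x within {0..s})" for x
    by (rule circle_coeff_power_derivative[OF w sub _ k])
  have main: "cmod (?G x - ?G 0) \<le> 4 * pi * B * x ^ (k + 1) / (k + 1) - 4 * pi * B * 0 ^ (k + 1) / (k + 1)"
    if x: "0 < x" "x \<le> s" for x
  proof (rule differentiable_bound_general[OF x(1), where f' = "\<lambda>x. 2 * of_real x ^ k * circle_coeff (int k - 1) P z x"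
        and \<phi>' = "\<lambda>x. 2 * x ^ k * (2 * pi * B)"])
    show "continuous_on {0..x} ?G"
      using continuous_on_subset[OF continuous_on_vector_derivative[OF d]] x by auto
  next
    fix y assume y: "0 < y" "y < x"
    then show "(?G has_vector_derivative 2 * of_real y ^ k * circle_coeff (int k - 1) P z y) (at y)"
      using d[of y] x by (simp add: at_within_Icc_at)
    have "cball z y \<subseteq> S" using sub y x subset_cball[of y s z] by auto
    then have "cmod (circle_coeff (int k - 1) P z y) \<le> 2 * pi * B"
      using y B by (intro norm_circle_coeff_le[OF wirtinger_onD(2)[OF w]]) auto
    then show "cmod (2 * of_real y ^ k * circle_coeff (int k - 1) P z y) \<le> 2 * y ^ k * (2 * pi * B)"
      using y mult_left_mono[of "cmod (circle_coeff (int k - 1) P z y)" "2 * pi * B" "2 * y ^ k"]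
      by (simp add: norm_mult norm_power mult.assoc)
    have "((\<lambda>x. x ^ Suc k) has_real_derivative (1 + real k) * y ^ k) (at y)"
      using DERIV_power[OF DERIV_ident, of "Suc k" y] by simp
    from DERIV_cmult[OF this, of "4 * pi * B / (k + 1)"]
    moreover have "4 * pi * B / (k + 1) * ((1 + real k) * y ^ k) = 2 * y ^ k * (2 * pi * B)"
      by (simp add: field_simps)
    ultimately show "((\<lambda>x. 4 * pi * B * x ^ (k + 1) / (k + 1)) has_vector_derivative 2 * y ^ k * (2 * pi * B)) (at y)"
      unfolding has_real_derivative_iff_has_vector_derivative[symmetric] by (simp add: mult_ac)
  qed (auto intro!: continuous_intros)
  show ?thesis
  proof (cases "s = 0")
    case True
    \<comment> \<open>Division by \<open>s ^ k\<close> is impossible at radius 0; the angular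
      identity shows that the coefficient is 0.\<close>
    have "of_real 0 * (circle_coeff (int k - 1) P z 0 - circle_coeff (int k + 1) Q z 0)
      = of_int (int k) * circle_coeff (int k) F z 0"
      using circle_coeff_angular[OF w, of z 0 "int k"] sub True by auto
    then show ?thesis using True k by simp
  next
    case False
    then have s: "s > 0" using s by simp
    have "s ^ k * cmod (circle_coeff (int k) F z s) \<le> s ^ k * (4 * pi * B * s / (k + 1))"
      using main[OF s] k s power_0_left[of k, where 'a = complex]
      by (simp add: norm_mult norm_power algebra_simps)
    then show ?thesis using s mult_left_le_imp_le[OF _ zero_less_power[OF s]] by blast
  qed
qed

text \<open>Dividing by the radius instead of multiplying reverses the cancellation: the
  \<open>P\<close> terms drop out and twice the \<open>Q\<close> term remains.\<close>

lemma circle_coeff_quotient_derivative: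
  assumes w: "wirtinger_on S F P Q" and sub: "cball z \<rho> \<subseteq> S" and s: "0 < s" "s < \<rho>"
  shows "((\<lambda>s. circle_coeff 1 F z s / of_real s) has_vector_derivative
           2 * circle_coeff 2 Q z s / of_real s) (at s)"
proof -
  have "cball z s \<subseteq> S" using sub s subset_cball by fastforce
  then have ang: "of_real s * (circle_coeff 0 P z s - circle_coeff 2 Q z s) = circle_coeff 1 F z s"
    using circle_coeff_angular[OF w, of z s 1] s by auto
  have inv: "((\<lambda>s. inverse (of_real s) :: complex) has_vector_derivative - inverse (of_real s) * inverse (of_real s)) (at s)"
    unfolding has_vector_derivative_def using s
    by (auto intro!: derivative_eq_intros ext simp: scaleR_conv_of_real algebra_simps)
  have "(circle_coeff 1 F z has_vector_derivative (circle_coeff 0 P z s + circle_coeff 2 Q z s)) (at s)"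
    using circle_coeff_has_derivative[OF w sub, of s 1] s by (simp add: at_within_Icc_at)
  from has_vector_derivative_mult[OF this inv] show ?thesis
    unfolding divide_inverse
    by (rule has_vector_derivative_eq_rhs) (use s in \<open>simp add: ang[symmetric] field_simps\<close>)
qed

section \<open>Gradient estimates for Poisson's equation\<close>

text \<open>\<open>g / 4\<close> is the mixed Wirtinger derivative of \<open>F\<close>.\<close>

definition poisson_on :: "complex set \<Rightarrow> (complex \<Rightarrow> complex) \<Rightarrow> (complex \<Rightarrow> complex) \<Rightarrow> (complex \<Rightarrow> complex) \<Rightarrow> (complex \<Rightarrow> complex) \<Rightarrow> bool" where
  "poisson_on S F P Q g \<longleftrightarrow> wirtinger_on S F P Q \<and>
     (\<exists>R. wirtinger_on S P R (\<lambda>z. g z / 4)) \<and> (\<exists>R. wirtinger_on S Q (\<lambda>z. g z / 4) R)"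

lemma poisson_on_cnj:
  assumes "poisson_on S F P Q g"
  shows "poisson_on S (\<lambda>z. cnj (F z)) (\<lambda>z. cnj (Q z)) (\<lambda>z. cnj (P z)) (\<lambda>z. cnj (g z))"
proof -
  obtain R1 R2 where "wirtinger_on S F P Q" "wirtinger_on S P R1 (\<lambda>z. g z / 4)"
    "wirtinger_on S Q (\<lambda>z. g z / 4) R2"
    using assms by (auto simp: poisson_on_def)
  from this[THEN wirtinger_on_cnj] show ?thesis
    unfolding poisson_on_def complex_cnj_divide complex_cnj_numeral by blast
qed

text \<open>The quotient has radial derivative \<open>2 * circle_coeff 2 Q z y / y\<close>. As the
  \<open>z\<close>-derivative of \<open>Q\<close> is \<open>g / 4\<close>, that coefficient is at
  most \<open>pi * M * y / 3\<close>, so the quotient moves away from its limit at the centre by at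
  most \<open>2 * pi * M / 3\<close> per unit of radius.\<close>

lemma circle_mean_gradient:
  assumes p: "poisson_on S F P Q g" and M: "\<And>w. w \<in> S \<Longrightarrow> cmod (g w) \<le> M"
    and sub: "cball z s \<subseteq> S" and s: "0 < s"
  shows "cmod (circle_coeff 1 F z s / of_real s - of_real (2 * pi) * P z) \<le> 2 * pi * M * s / 3"
proof -
  obtain R1 R2 where w: "wirtinger_on S F P Q" and wP: "wirtinger_on S P R1 (\<lambda>z. g z / 4)"
    and wQ: "wirtinger_on S Q (\<lambda>z. g z / 4) R2"
    using p by (auto simp: poisson_on_def)
  have sub': "y \<le> s \<Longrightarrow> cball z y \<subseteq> S" for y
    using sub subset_cball[of y s z] by auto
  have Q2: "cmod (circle_coeff 2 Q z y) \<le> pi * M * y / 3" if "0 \<le> y" "y \<le> s" for y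
    using norm_circle_coeff_le_radius[OF wQ sub'[OF that(2)] that(1), of 2 "M/4"] M by (simp add: norm_divide)
  \<comment> \<open>The angular form of \<open>circle_coeff 1 F z y / y\<close>; unlike the quotient
    it is continuous up to \<open>y = 0\<close>, where its value is
    \<open>2 * pi * P z\<close>.\<close>
  let ?\<phi> = "\<lambda>y. circle_coeff 0 P z y - circle_coeff 2 Q z y"
  have eq: "?\<phi> y = circle_coeff 1 F z y / of_real y" if "0 < y" "y \<le> s" for y
    using circle_coeff_angular[OF w sub'[OF that(2)], of 1] that by (simp add: field_simps)
  have "cmod (?\<phi> s - ?\<phi> 0) \<le> 2 * pi * M / 3 * s - 2 * pi * M / 3 * 0"
  proof (rule differentiable_bound_general[OF s, where f' = "\<lambda>y. 2 * circle_coeff 2 Q z y / of_real y"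
        and \<phi>' = "\<lambda>y. 2 * pi * M / 3"])
    show "continuous_on {0..s} ?\<phi>"
      using circle_coeff_has_derivative[OF wP sub] circle_coeff_has_derivative[OF wQ sub]
      by (intro continuous_on_diff continuous_on_vector_derivative) blast+
  next
    fix y assume y: "0 < y" "y < s"
    show "(?\<phi> has_vector_derivative 2 * circle_coeff 2 Q z y / of_real y) (at y)"
    proof (rule has_vector_derivative_transform_within_open[OF circle_coeff_quotient_derivative[OF w sub y]])
      show "open {0<..<s}" "y \<in> {0<..<s}" using y by auto
    qed (use eq in auto)
    show "cmod (2 * circle_coeff 2 Q z y / of_real y) \<le> 2 * pi * M / 3"
      using Q2[of y] y by (simp add: norm_mult norm_divide field_simps)
    show "((\<lambda>y. 2 * pi * M / 3 * y) has_vector_derivative 2 * pi * M / 3) (at y)"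
      unfolding has_real_derivative_iff_has_vector_derivative[symmetric]
      by (auto intro!: derivative_eq_intros)
  qed (auto intro!: continuous_intros)
  moreover have "?\<phi> 0 = of_real (2 * pi) * P z"
    using Q2[of 0] s by (simp add: circle_coeff_def scaleR_conv_of_real)
  ultimately show ?thesis
    using eq[of s] s by (simp add: mult.commute mult.left_commute)
qed

text \<open>The circle mean is bounded through the values of \<open>F\<close> on a single circle,
  its distance from the gradient through \<open>g\<close>.\<close>

lemma norm_gradient_le:
  assumes p: "poisson_on S F P Q g" and M: "\<And>w. w \<in> S \<Longrightarrow> cmod (g w) \<le> M"
    and K: "\<And>t. cmod (F (z + of_real s * cis t)) \<le> K"
    and sub: "cball z s \<subseteq> S" and s: "0 < s"
  shows "cmod (P z) \<le> K / s + M * s / 3"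
proof -
  have contF: "continuous_on S F"
    using p by (auto simp: poisson_on_def wirtinger_on_continuous)
  have "cmod (circle_coeff 1 F z s) \<le> integral {0..2*pi} (\<lambda>t. K)"
    unfolding circle_coeff_def using s K
    by (intro integral_norm_bound_integral circle_coeff_integrable[OF contF sub])
       (auto simp: norm_mult)
  then have "cmod (circle_coeff 1 F z s / of_real s) \<le> 2 * pi * K / s"
    using s by (simp add: norm_divide field_simps)
  moreover have "cmod (of_real (2 * pi) * P z) \<le> cmod (circle_coeff 1 F z s / of_real s)
     + cmod (circle_coeff 1 F z s / of_real s - of_real (2 * pi) * P z)"
    using norm_triangle_ineq4[of "circle_coeff 1 F z s / of_real s" "circle_coeff 1 F z s / of_real s - of_real (2 * pi) * P z"]
    by simp
  ultimately have "2 * pi * cmod (P z) \<le> 2 * pi * (K / s + M * s / 3)"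
    using circle_mean_gradient[OF p M sub s] by (simp add: norm_mult algebra_simps)
  then show ?thesis by simp
qed

text \<open>The quotient by the radius is followed inwards from \<open>\<rho>\<close>. Its
  derivative contains the coefficient of order 2 of \<open>g / 4\<close>, for which boundedness of
  \<open>g\<close> yields no factor \<open>s\<close>; it is therefore of size \<open>1 / s\<close>
  and integrates to the logarithm.\<close>

lemma norm_circle_mean_second_derivative:
  assumes w: "wirtinger_on S P R (\<lambda>z. g z / 4)" and M: "\<And>w. w \<in> S \<Longrightarrow> cmod (g w) \<le> M"
    and K: "\<And>w. w \<in> cball z \<rho> \<Longrightarrow> cmod (P w) \<le> K"
    and sub: "cball z \<rho> \<subseteq> S" and s: "0 < s" "s \<le> \<rho>"
  shows "cmod (circle_coeff 1 P z s) \<le> s * (2 * pi * K / \<rho> + pi * M * ln (\<rho> / s))"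
proof -
  let ?B = "\<lambda>s. circle_coeff 1 P z s / of_real s"
  have outer: "cmod (?B \<rho>) \<le> 2 * pi * K / \<rho>"
    using norm_circle_coeff_le[OF wirtinger_on_continuous[OF w] sub, of K 1] K s
    by (simp add: norm_divide divide_right_mono)
  have "cmod (?B \<rho> - ?B s) \<le> pi * M * ln \<rho> - pi * M * ln s"
  proof (cases "s = \<rho>")
    case False
    then have lt: "s < \<rho>" using s by simp
    show ?thesis
    proof (rule differentiable_bound_general[OF lt, where f' = "\<lambda>s. 2 * circle_coeff 2 (\<lambda>z. g z / 4) z s / of_real s"
          and \<phi>' = "\<lambda>s. pi * M / s"])
      have "continuous_on {0..\<rho>} (circle_coeff 1 P z)"
        using circle_coeff_has_derivative[OF w sub] by (intro continuous_on_vector_derivative) blast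
      then show "continuous_on {s..\<rho>} ?B"
        using s by (intro continuous_intros continuous_on_subset[where t = "{s..\<rho>}" and s = "{0..\<rho>}"]) auto
      show "continuous_on {s..\<rho>} (\<lambda>s. pi * M * ln s)"
        using s by (intro continuous_intros) auto
    next
      fix x assume x: "s < x" "x < \<rho>"
      then show "(?B has_vector_derivative 2 * circle_coeff 2 (\<lambda>z. g z / 4) z x / of_real x) (at x)"
        using s by (intro circle_coeff_quotient_derivative[OF w sub]) auto
      show "((\<lambda>x. pi * M * ln x) has_vector_derivative pi * M / x) (at x)"
        unfolding has_real_derivative_iff_has_vector_derivative[symmetric]
        using x s by (auto intro!: derivative_eq_intros)
      have "cmod (circle_coeff 2 (\<lambda>z. g z / 4) z x) \<le> 2 * pi * (M / 4)"
      proof (rule norm_circle_coeff_le[OF wirtinger_onD(3)[OF w]])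
        show subx: "cball z x \<subseteq> S"
          using x sub subset_cball[of x \<rho> z] by auto
        show "cmod (g w / 4) \<le> M / 4" if "w \<in> cball z x" for w
          using M that subx by (simp add: norm_divide subset_eq)
      qed (use x s in auto)
      then show "cmod (2 * circle_coeff 2 (\<lambda>z. g z / 4) z x / of_real x) \<le> pi * M / x"
        using x s by (simp add: norm_mult norm_divide field_simps)
    qed
  qed simp
  moreover have "cmod (?B s) \<le> cmod (?B \<rho>) + cmod (?B \<rho> - ?B s)"
    using norm_triangle_ineq4[of "?B \<rho>" "?B \<rho> - ?B s"] by simp
  ultimately have "cmod (?B s) \<le> 2 * pi * K / \<rho> + pi * M * ln (\<rho> / s)"
    using outer s by (simp add: ln_div algebra_simps)
  then show ?thesis
    using s by (simp add: norm_divide field_simps)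
qed

text \<open>Mean value inequality along the segment from 0 to \<open>z\<close> at a fixed radius,
  with the derivative taken under the integral sign.\<close>

lemma norm_circle_coeff_translate_le:
  assumes w: "wirtinger_on S F P Q" and sub: "\<And>t. t \<in> {0..1} \<Longrightarrow> cball (of_real t * z) s \<subseteq> S" and s: "0 \<le> s"
    and B: "\<And>t. t \<in> {0..1} \<Longrightarrow> cmod (circle_coeff n P (of_real t * z) s) + cmod (circle_coeff n Q (of_real t * z) s) \<le> B"
  shows "cmod (circle_coeff n F z s - circle_coeff n F 0 s) \<le> cmod z * B"
proof -
  note cont = wirtinger_onD(2,3)[OF w] wirtinger_on_continuous[OF w]
  have inS: "x \<in> {0..1} \<Longrightarrow> of_real x * z + of_real s * cis t \<in> S" for x t
    using circle_in_cball[of s s "of_real x * z" t] sub[of x] s by auto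
  let ?D = "\<lambda>x. z * circle_coeff n P (of_real x * z) s + cnj z * circle_coeff n Q (of_real x * z) s"
  have d: "((\<lambda>x. circle_coeff n F (of_real x * z) s) has_vector_derivative ?D x) (at x within {0..1})"
    if x: "x \<in> {0..1}" for x
  proof -
    have "((\<lambda>x. integral (cbox 0 (2*pi)) (\<lambda>t. F (of_real x * z + of_real s * cis t) * cis (- of_int n * t)))
      has_vector_derivative
      integral (cbox 0 (2*pi)) (\<lambda>t. (P (of_real x * z + of_real s * cis t) * z + Q (of_real x * z + of_real s * cis t) * cnj z) * cis (- of_int n * t)))
      (at x within {0..1})"
    proof (rule leibniz_rule_vector_derivative)
      fix x t :: real assume x: "x \<in> {0..1}"
      have "((\<lambda>x. of_real x * z + of_real s * cis t) has_vector_derivative z) (at x within {0..1})"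
        by (auto intro!: derivative_eq_intros simp: has_vector_derivative_def scaleR_conv_of_real)
      from wirtinger_on_curve[OF w inS[OF x] this]
      show "((\<lambda>x. F (of_real x * z + of_real s * cis t) * cis (- of_int n * t)) has_vector_derivative
         (P (of_real x * z + of_real s * cis t) * z + Q (of_real x * z + of_real s * cis t) * cnj z) * cis (- of_int n * t))
         (at x within {0..1})"
        by (rule has_vector_derivative_mult_left)
    next
      fix x :: real assume x: "x \<in> {0..1}"
      then show "(\<lambda>t. F (of_real x * z + of_real s * cis t) * cis (- of_int n * t)) integrable_on cbox 0 (2 * pi)"
        using circle_coeff_integrable[OF cont(3) sub[OF x] s] by auto
    next
      show "continuous_on ({0..1} \<times> cbox 0 (2 * pi))
       (\<lambda>(x, t). (P (of_real x * z + of_real s * cis t) * z + Q (of_real x * z + of_real s * cis t) * cnj z) * cis (- of_int n * t))"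
        unfolding split_beta using inS
        by (intro continuous_intros continuous_on_compose2[OF cont(1)] continuous_on_compose2[OF cont(2)]) auto
    qed (use x in auto)
    moreover have "integral {0..2*pi} (\<lambda>t. (P (of_real x * z + of_real s * cis t) * z + Q (of_real x * z + of_real s * cis t) * cnj z) * cis (- of_int n * t)) = ?D x"
      unfolding circle_coeff_def
    proof (rule integral_unique, rule has_integral_eq)
      show "((\<lambda>t. z * (P (of_real x * z + of_real s * cis t) * cis (- of_int n * t)) +
          cnj z * (Q (of_real x * z + of_real s * cis t) * cis (- of_int n * t))) has_integral
          z * integral {0..2*pi} (\<lambda>t. P (of_real x * z + of_real s * cis t) * cis (- of_int n * t)) +
          cnj z * integral {0..2*pi} (\<lambda>t. Q (of_real x * z + of_real s * cis t) * cis (- of_int n * t))) {0..2*pi}"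
        by (intro has_integral_add has_integral_mult_right integrable_integral
          circle_coeff_integrable[OF cont(1) sub[OF x] s] circle_coeff_integrable[OF cont(2) sub[OF x] s])
    qed (simp add: algebra_simps)
    ultimately show ?thesis
      by (simp add: circle_coeff_def)
  qed
  have "norm (circle_coeff n F (of_real 1 * z) s - circle_coeff n F (of_real 0 * z) s) \<le> cmod z * B * norm (1 - 0 :: real)"
  proof (rule differentiable_bound[of "{0..1}"])
    fix x :: real assume x: "x \<in> {0..1}"
    show "((\<lambda>x. circle_coeff n F (of_real x * z) s) has_derivative (\<lambda>h. h *\<^sub>R ?D x)) (at x within {0..1})"
      using d[OF x] by (simp add: has_vector_derivative_def)
    have "cmod (?D x) \<le> cmod z * cmod (circle_coeff n P (of_real x * z) s) + cmod z * cmod (circle_coeff n Q (of_real x * z) s)"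
      by (rule order_trans[OF norm_triangle_ineq]) (simp add: norm_mult)
    also have "\<dots> \<le> cmod z * B"
      using mult_left_mono[OF B[OF x], of "cmod z"] by (simp add: algebra_simps)
    finally show "onorm (\<lambda>h. h *\<^sub>R ?D x) \<le> cmod z * B"
      by (intro onorm_le) (simp add: mult.commute mult_left_mono)
  qed auto
  then show ?thesis by simp
qed


section \<open>Harmonic polynomials\<close>

text \<open>On the circle \<open>cnj z = 1 / z\<close>, so real parts of polynomials form an algebra there.\<close>

lemma Re_poly_mult_on_circle:
  fixes p q :: "complex poly"
  shows "\<exists>r. \<forall>z\<in>sphere 0 1. Re (poly p z) * Re (poly q z) = Re (poly r z)"
proof -
  define R where "R u \<longleftrightarrow> (\<exists>r. \<forall>z\<in>sphere 0 1. u z = Re (poly r z))" for u :: "complex \<Rightarrow> real"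
  have add: "R (\<lambda>z. u z + v z)" if uv: "R u" "R v" for u v
  proof -
    obtain r s where "\<forall>z\<in>sphere 0 1. u z = Re (poly r z)" "\<forall>z\<in>sphere 0 1. v z = Re (poly s z)"
      using uv by (auto simp: R_def)
    then show ?thesis unfolding R_def by (intro exI[of _ "r + s"]) auto
  qed
  have sum: "R (\<lambda>z. \<Sum>i\<in>I. u i z)" if "finite I" "\<And>i. i \<in> I \<Longrightarrow> R (u i)" for I :: "nat set" and u
    using that
  proof (induction I rule: finite_induct)
    case empty
    then show ?case by (auto simp: R_def intro: exI[of _ 0])
  next
    case (insert i I)
    then show ?case by (simp add: add)
  qed
  \<comment> \<open>With \<open>z * cnj z = 1\<close> the lower power cancels; if
    \<open>j > i\<close>, passing to the conjugate keeps the real part and makes the remaining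
    exponent nonnegative.\<close>
  have conj_part: "R (\<lambda>z. Re (a * z ^ i * cnj (b * z ^ j)))" for a b i j
  proof (cases "j \<le> i")
    case True
    have "a * z ^ i * cnj (b * z ^ j) = poly (monom (a * cnj b) (i - j)) z" if "z \<in> sphere 0 1" for z
    proof -
      have "z * cnj z = 1" using that complex_norm_square[of z] by simp
      then have "(z * cnj z) ^ j = 1" by simp
      moreover have "z ^ i = z ^ (i - j) * z ^ j" using True by (simp flip: power_add)
      ultimately show ?thesis by (simp add: poly_monom power_mult_distrib)
    qed
    then show ?thesis unfolding R_def by metis
  next
    case False
    have "Re (a * z ^ i * cnj (b * z ^ j)) = Re (poly (monom (cnj a * b) (j - i)) z)" if "z \<in> sphere 0 1" for z
    proof -
      have "cnj z * z = 1" using that complex_norm_square[of z] by (simp add: mult.commute)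
      then have "(cnj z * z) ^ i = 1" by simp
      moreover have "z ^ j = z ^ (j - i) * z ^ i" using False by (simp flip: power_add)
      ultimately have "cnj (a * z ^ i * cnj (b * z ^ j)) = poly (monom (cnj a * b) (j - i)) z"
        by (simp add: poly_monom power_mult_distrib)
      from arg_cong[OF this, of Re] show ?thesis by (simp only: cnj.simps)
    qed
    then show ?thesis unfolding R_def by blast
  qed
  have prod: "R (\<lambda>z. Re (a * z ^ i) * Re (b * z ^ j))" for a b i j
  proof -
    have eq: "Re x * Re y = Re (x * y / 2) + Re (x / 2 * cnj y)" for x y :: complex
      by (simp add: field_simps)
    have "R (\<lambda>z. Re (a * z ^ i * (b * z ^ j) / 2))"
      unfolding R_def by (intro exI[of _ "monom (a * b / 2) (i + j)"]) (simp add: poly_monom power_add mult_ac)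
    moreover have "R (\<lambda>z. Re (a * z ^ i / 2 * cnj (b * z ^ j)))"
      using conj_part[of "a / 2" i b j] by simp
    ultimately show ?thesis
      unfolding eq by (rule add)
  qed
  have "R (\<lambda>z. \<Sum>i\<le>degree p. \<Sum>j\<le>degree q. Re (coeff p i * z ^ i) * Re (coeff q j * z ^ j))"
    by (intro sum prod) auto
  then show ?thesis
    unfolding R_def by (simp add: poly_altdef sum_product)
qed

text \<open>Stone-Weierstrass for the algebra of real parts of polynomials; those of
  \<open>z\<close> and \<open>\<i> * z\<close> already separate points.\<close>

lemma real_approx_Re_poly_on_circle:
  fixes u :: "complex \<Rightarrow> real"
  assumes u: "continuous_on (sphere 0 1) u" and e: "e > 0"
  obtains p :: "complex poly" where "\<And>z. z \<in> sphere 0 1 \<Longrightarrow> \<bar>u z - Re (poly p z)\<bar> < e"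
proof -
  interpret function_ring_on "{u. \<exists>p. \<forall>z\<in>sphere 0 1. u z = Re (poly p z)}" "sphere 0 1 :: complex set"
  proof unfold_locales
    fix x y :: complex assume xy: "x \<noteq> y"
    have "\<exists>p. Re (poly p x) \<noteq> Re (poly p y)"
    proof (cases "Re x = Re y")
      case False
      then show ?thesis by (intro exI[of _ "[:0, 1:]"]) simp
    next
      case True
      then show ?thesis using xy by (intro exI[of _ "[:0, \<i>:]"]) (simp add: complex_eq_iff)
    qed
    then obtain p where "Re (poly p x) \<noteq> Re (poly p y)" by blast
    then show "\<exists>f\<in>{u. \<exists>p. \<forall>z\<in>sphere 0 1. u z = Re (poly p z)}. f x \<noteq> f y"
      by (intro bexI[of _ "\<lambda>z. Re (poly p z)"]) auto
  next
    fix f :: "complex \<Rightarrow> real" assume "f \<in> {u. \<exists>p. \<forall>z\<in>sphere 0 1. u z = Re (poly p z)}"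
    then obtain p where p: "\<And>z. z \<in> sphere 0 1 \<Longrightarrow> f z = Re (poly p z)" by auto
    have "continuous_on (sphere 0 1) (\<lambda>z. Re (poly p z))" by (intro continuous_intros)
    then show "continuous_on (sphere 0 1) f"
      by (rule continuous_on_eq) (simp add: p)
  next
    fix f g :: "complex \<Rightarrow> real"
    assume "f \<in> {u. \<exists>p. \<forall>z\<in>sphere 0 1. u z = Re (poly p z)}" "g \<in> {u. \<exists>p. \<forall>z\<in>sphere 0 1. u z = Re (poly p z)}"
    then obtain p q where p: "\<And>z. z \<in> sphere 0 1 \<Longrightarrow> f z = Re (poly p z)"
      and q: "\<And>z. z \<in> sphere 0 1 \<Longrightarrow> g z = Re (poly q z)" by auto
    show "(\<lambda>x. f x + g x) \<in> {u. \<exists>p. \<forall>z\<in>sphere 0 1. u z = Re (poly p z)}"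
      using p q by (auto intro!: exI[of _ "p + q"])
    show "(\<lambda>x. f x * g x) \<in> {u. \<exists>p. \<forall>z\<in>sphere 0 1. u z = Re (poly p z)}"
      using p q Re_poly_mult_on_circle[of p q] by auto
  next
    fix c :: real
    show "(\<lambda>_. c) \<in> {u. \<exists>p. \<forall>z\<in>sphere 0 1. u z = Re (poly p z)}"
      by (auto intro!: exI[of _ "[:of_real c:]"])
  qed auto
  obtain g p where "\<forall>z\<in>sphere 0 1. \<bar>u z - g z\<bar> < e" "\<forall>z\<in>sphere 0 1. g z = Re (poly p z)"
    using Stone_Weierstrass_basic[OF u e] by blast
  then show ?thesis
    by (intro that[of p]) auto
qed

text \<open>Real and imaginary part are approximated separately by \<open>Re p\<close> and
  \<open>Re q\<close>; \<open>A\<close> and \<open>B\<close> are the combinations with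
  \<open>A + cnj B = Re p + \<i> * Re q\<close>.\<close>

lemma harmonic_poly_approx_on_circle:
  fixes f :: "complex \<Rightarrow> complex"
  assumes f: "continuous_on (sphere 0 1) f" and e: "e > 0"
  obtains A B :: "complex poly" where "\<And>z. z \<in> sphere 0 1 \<Longrightarrow> cmod (f z - (poly A z + cnj (poly B z))) < e"
proof -
  obtain p where p: "\<And>z. z \<in> sphere 0 1 \<Longrightarrow> \<bar>Re (f z) - Re (poly p z)\<bar> < e / 2"
    using real_approx_Re_poly_on_circle[of "\<lambda>z. Re (f z)" "e / 2"] f e by (auto intro: continuous_intros)
  obtain q where q: "\<And>z. z \<in> sphere 0 1 \<Longrightarrow> \<bar>Im (f z) - Re (poly q z)\<bar> < e / 2"
    using real_approx_Re_poly_on_circle[of "\<lambda>z. Im (f z)" "e / 2"] f e by (auto intro: continuous_intros)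
  define A B where "A = smult (1 / 2) (p + smult \<i> q)" and "B = smult (1 / 2) (p - smult \<i> q)"
  have eq: "poly A z + cnj (poly B z) = Complex (Re (poly p z)) (Re (poly q z))" for z
    by (simp add: A_def B_def complex_eq_iff field_simps)
  show ?thesis
  proof
    fix z :: complex assume z: "z \<in> sphere 0 1"
    have "cmod (f z - (poly A z + cnj (poly B z))) \<le> \<bar>Re (f z) - Re (poly p z)\<bar> + \<bar>Im (f z) - Re (poly q z)\<bar>"
      using cmod_le[of "f z - (poly A z + cnj (poly B z))"] unfolding eq by simp
    also have "\<dots> < e" using p[OF z] q[OF z] by simp
    finally show "cmod (f z - (poly A z + cnj (poly B z))) < e" .
  qed
qed

section \<open>The integral of the absolute value of the cosine over its periods\<close>

lemma abs_cos_has_integral_half_period: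
  "((\<lambda>x. \<bar>cos x\<bar>) has_integral 2) {pi * of_int k - pi / 2..pi * of_int k + pi / 2}"
proof -
  have "((\<lambda>x. cos (x - pi * of_int k)) has_integral
      (sin (pi * of_int k + pi / 2 - pi * of_int k) - sin (pi * of_int k - pi / 2 - pi * of_int k)))
      {pi * of_int k - pi / 2..pi * of_int k + pi / 2}"
    by (intro fundamental_theorem_of_calculus)
       (auto intro!: derivative_eq_intros simp: has_real_derivative_iff_has_vector_derivative[symmetric])
  then have "((\<lambda>x. cos (x - pi * of_int k)) has_integral 2) {pi * of_int k - pi / 2..pi * of_int k + pi / 2}"
    by simp
  then show ?thesis
  proof (rule has_integral_eq[rotated])
    fix x assume "x \<in> {pi * of_int k - pi / 2..pi * of_int k + pi / 2}"
    then have "0 \<le> cos (x - pi * of_int k)" by (intro cos_ge_zero) auto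
    moreover have "\<bar>cos (x - pi * of_int k)\<bar> = \<bar>cos x\<bar>"
      by (simp add: cos_diff cos_npi_int sin_npi_int)
    ultimately show "cos (x - pi * of_int k) = \<bar>cos x\<bar>" by simp
  qed
qed

lemma abs_cos_has_integral_half_periods:
  "((\<lambda>x. \<bar>cos x\<bar>) has_integral 2 * real m)
     {pi * of_int k - pi / 2..pi * of_int k - pi / 2 + pi * real m}"
proof (induction m)
  case 0
  then show ?case by (simp add: has_integral_refl)
next
  case (Suc m)
  have eq: "pi * of_int k - pi / 2 + pi * real m = pi * of_int (k + int m) - pi / 2"
    "pi * of_int k - pi / 2 + pi * real (Suc m) = pi * of_int (k + int m) + pi / 2"
    by (simp_all add: algebra_simps)
  have "((\<lambda>x. \<bar>cos x\<bar>) has_integral (2 * real m + 2))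
     {pi * of_int k - pi / 2..pi * of_int (k + int m) + pi / 2}"
  proof (rule has_integral_combine[where c = "pi * of_int (k + int m) - pi / 2"])
    show "((\<lambda>x. \<bar>cos x\<bar>) has_integral 2 * real m) {pi * of_int k - pi / 2..pi * of_int (k + int m) - pi / 2}"
      using Suc unfolding eq .
  qed (use abs_cos_has_integral_half_period[of "k + int m"] in \<open>auto simp: algebra_simps\<close>)
  moreover have "2 * real (Suc m) = 2 * real m + 2" by simp
  ultimately show ?case unfolding eq by (simp only:)
qed

text \<open>So far only windows starting at a zero of the cosine are covered. For such a start
  \<open>a\<close> below \<open>c\<close>, translation by \<open>pi * m\<close> exchanges the piece
  from \<open>a\<close> to \<open>c\<close> for the piece that sticks out on the right.\<close>

lemma integral_abs_cos_period:
  "integral {c..c + pi * real m} (\<lambda>x. \<bar>cos x\<bar>) = 2 * real m"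
proof -
  define k where "k = \<lfloor>c / pi\<rfloor>"
  define a where "a = pi * of_int k - pi / 2"
  have "of_int k \<le> c / pi" unfolding k_def by linarith
  then have "pi * of_int k \<le> c" by (simp add: field_simps)
  then have ac: "a \<le> c" unfolding a_def using pi_gt_zero by linarith
  have int: "(\<lambda>x. \<bar>cos x\<bar>) integrable_on {x..y}" for x y :: real
    by (intro integrable_continuous_real continuous_intros)
  have "integral {a..a + pi * real m} (\<lambda>x. \<bar>cos x\<bar>) + integral {a + pi * real m..c + pi * real m} (\<lambda>x. \<bar>cos x\<bar>)
     = integral {a..c + pi * real m} (\<lambda>x. \<bar>cos x\<bar>)"
    using ac by (intro Henstock_Kurzweil_Integration.integral_combine int) auto
  also have "\<dots> = integral {a..c} (\<lambda>x. \<bar>cos x\<bar>) + integral {c..c + pi * real m} (\<lambda>x. \<bar>cos x\<bar>)"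
    using ac by (intro Henstock_Kurzweil_Integration.integral_combine[symmetric] int) auto
  also have "integral {a..c} (\<lambda>x. \<bar>cos x\<bar>) = integral {a + pi * real m..c + pi * real m} (\<lambda>x. \<bar>cos x\<bar>)"
  proof -
    have "integral {a..c} ((\<lambda>x. \<bar>cos x\<bar>) \<circ> (\<lambda>x. x + pi * real m))
       = integral {a + pi * real m..c + pi * real m} (\<lambda>x. \<bar>cos x\<bar>)"
      using integral_shift_Icc_real[of a c "\<lambda>x. \<bar>cos x\<bar>" "pi * real m"] by (simp add: o_def add.commute)
    moreover have "\<bar>cos (x + pi * real m)\<bar> = \<bar>cos x\<bar>" for x
      using cos_npi[of m] sin_npi[of m] by (simp add: cos_add mult.commute abs_mult)
    ultimately show ?thesis by (simp add: o_def)
  qed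
  finally have "integral {c..c + pi * real m} (\<lambda>x. \<bar>cos x\<bar>) = integral {a..a + pi * real m} (\<lambda>x. \<bar>cos x\<bar>)"
    by simp
  then show ?thesis
    using integral_unique[OF abs_cos_has_integral_half_periods[of m k]] by (simp add: a_def)
qed

lemma abs_cos_linear_has_integral:
  assumes "n \<ge> (1 :: nat)"
  shows "((\<lambda>t. \<bar>cos (real n * t + c)\<bar>) has_integral 4) {0..2 * pi}"
proof -
  have "((\<lambda>x. \<bar>cos x\<bar>) has_integral 2 * real (2 * n)) (cbox c (c + pi * real (2 * n)))"
    unfolding integral_abs_cos_period[of c "2 * n", symmetric] cbox_interval
    by (intro integrable_integral integrable_continuous_real continuous_intros)
  from has_integral_affinity'[OF this, of "real n" c]
  have "((\<lambda>t. \<bar>cos (real n * t + c)\<bar>) has_integral (2 * real (2 * n) / real n))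
      {0..(c + pi * real (2 * n)) / real n - c / real n}"
    using assms by (simp add: field_simps)
  then show ?thesis
    using assms by (simp add: field_simps)
qed

section \<open>Fourier coefficients of harmonic polynomials\<close>

lemma cis_frequency_has_integral:
  "((\<lambda>t. cis (of_int k * t)) has_integral (if k = 0 then 2 * pi else 0)) {0..2*pi}"
proof (cases "k = 0")
  case True
  then show ?thesis using has_integral_const_real[of "1::complex" 0 "2*pi"] by (simp add: scaleR_conv_of_real)
next
  case False
  let ?F = "\<lambda>t. cis (of_int k * t) / (\<i> * of_int k)"
  have "((\<lambda>t. cis (of_int k * t)) has_integral (?F (2*pi) - ?F 0)) {0..2*pi}"
  proof (rule fundamental_theorem_of_calculus)
    fix t :: real
    have "(?F has_derivative (\<lambda>h. (h * of_int k) *\<^sub>R (\<i> * cis (of_int k * t)) / (\<i> * of_int k))) (at t within {0..2*pi})"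
      by (rule derivative_eq_intros refl | use False in \<open>simp add: field_simps\<close>)+
    then show "(?F has_vector_derivative cis (of_int k * t)) (at t within {0..2*pi})"
      using False by (simp add: has_vector_derivative_def scaleR_conv_of_real field_simps)
  qed auto
  moreover have "cis (of_int k * (2 * pi)) = 1"
    using cis_multiple_2pi[of "of_int k"] by (simp add: mult.commute mult.left_commute)
  ultimately show ?thesis using False by simp
qed

lemma poly_frequency_has_integral:
  fixes p :: "complex poly" and m :: int
  shows "((\<lambda>t. poly p (cis t) * cis (of_int m * t)) has_integral
            (2 * pi * (if m \<le> 0 then coeff p (nat (- m)) else 0))) {0..2*pi}"
proof -
  have "((\<lambda>t. \<Sum>k\<le>degree p. coeff p k * cis (of_int (int k + m) * t)) has_integral
      (\<Sum>k\<le>degree p. coeff p k * (if int k + m = 0 then 2 * pi else 0))) {0..2*pi}"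
    by (intro has_integral_sum has_integral_mult_right cis_frequency_has_integral) auto
  moreover have "(\<Sum>k\<le>degree p. coeff p k * cis (of_int (int k + m) * t)) = poly p (cis t) * cis (of_int m * t)" for t
    by (simp add: poly_altdef sum_distrib_right Complex.DeMoivre mult.assoc cis_mult distrib_left mult.commute[of _ t])
  moreover have "(\<Sum>k\<le>degree p. coeff p k * (if int k + m = 0 then 2 * pi else 0))
      = 2 * pi * (if m \<le> 0 then coeff p (nat (- m)) else 0)"
  proof (cases "m \<le> 0")
    case True
    then have "(\<Sum>k\<le>degree p. coeff p k * (if int k + m = 0 then 2 * pi else 0))
        = (\<Sum>k\<le>degree p. if k = nat (- m) then coeff p k * (2 * pi) else 0)"
      by (intro sum.cong) auto
    then show ?thesis
      using True coeff_eq_0[of p "nat (- m)"] by (auto simp: mult.commute)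
  next
    case False
    then show ?thesis by (auto intro!: sum.neutral)
  qed
  ultimately show ?thesis by simp
qed

lemma cis_minus_Arg_mult: "cis (- Arg z) * z = of_real (cmod z)"
proof -
  have "cis (- Arg z) * rcis (cmod z) (Arg z) = of_real (cmod z)"
    by (simp add: rcis_def cis_mult mult.left_commute)
  then show ?thesis by (simp add: rcis_cmod_Arg)
qed

text \<open>Duality: \<open>?h\<close> is tested against a combination of the frequencies
  \<open>n\<close> and \<open>- n\<close>. The phases \<open>\<phi>\<close> and
  \<open>\<psi>\<close> turn the coefficients into their moduli, so the integral is
  \<open>2 * pi\<close> times their sum, while the test function has modulus twice that of a cosine,
  with integral 8.\<close>

lemma harmonic_poly_coeff_bound:
  fixes A B :: "complex poly"
  assumes bnd: "\<And>z. z \<in> sphere 0 1 \<Longrightarrow> cmod (poly A z + cnj (poly B z)) \<le> M" and n: "n \<ge> 1"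
  shows "cmod (coeff A n) + cmod (coeff B n) \<le> 4 * M / pi"
proof -
  let ?a = "coeff A n" and ?b = "cnj (coeff B n)"
  let ?h = "\<lambda>t. poly A (cis t) + cnj (poly B (cis t))"
  define \<phi> \<psi> where "\<phi> = - Arg ?a" and "\<psi> = - Arg ?b"
  have a: "cis \<phi> * ?a = of_real (cmod ?a)"
    unfolding \<phi>_def by (rule cis_minus_Arg_mult)
  have b: "cis \<psi> * ?b = of_real (cmod ?b)"
    unfolding \<psi>_def by (rule cis_minus_Arg_mult)
  \<comment> \<open>\<open>A\<close> contributes for \<open>m \<le> 0\<close> and the conjugate of
    \<open>B\<close> for \<open>m \<ge> 0\<close>; at \<open>m = n\<close> and
    \<open>m = - n\<close> with \<open>n \<ge> 1\<close> exactly one of them survives.\<close>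
  have hn: "((\<lambda>t. ?h t * cis (of_int m * t)) has_integral
      (2 * pi * (if m \<le> 0 then coeff A (nat (- m)) else 0) + cnj (2 * pi * (if - m \<le> 0 then coeff B (nat m) else 0)))) {0..2*pi}" for m
  proof -
    have "((\<lambda>t. cnj (poly B (cis t) * cis (of_int (- m) * t))) has_integral
        cnj (2 * pi * (if - m \<le> 0 then coeff B (nat (- (- m))) else 0))) {0..2*pi}"
      using has_integral_linear[OF poly_frequency_has_integral[of B "- m"] bounded_linear_cnj] by (simp add: o_def)
    then have "((\<lambda>t. cnj (poly B (cis t)) * cis (of_int m * t)) has_integral
        cnj (2 * pi * (if - m \<le> 0 then coeff B (nat m) else 0))) {0..2*pi}"
      by (simp add: cis_cnj cong: if_cong)
    from has_integral_add[OF poly_frequency_has_integral[of A m] this]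
    show ?thesis by (simp add: distrib_right)
  qed
  have "((\<lambda>t. cis \<phi> * (?h t * cis (of_int (- int n) * t)) + cis \<psi> * (?h t * cis (of_int (int n) * t)))
      has_integral (cis \<phi> * (2 * pi * ?a) + cis \<psi> * (2 * pi * ?b))) {0..2*pi}"
    using has_integral_add[OF has_integral_mult_right[OF hn[of "- int n"], of "cis \<phi>"]
       has_integral_mult_right[OF hn[of "int n"], of "cis \<psi>"]] n by simp
  moreover have "cis \<phi> * (2 * pi * ?a) + cis \<psi> * (2 * pi * ?b) = of_real (2 * pi * (cmod ?a + cmod ?b))"
    unfolding of_real_mult of_real_add a[symmetric] b[symmetric] by (simp add: algebra_simps)
  ultimately have I: "((\<lambda>t. ?h t * (cis \<phi> * cis (- (real n * t)) + cis \<psi> * cis (real n * t)))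
      has_integral of_real (2 * pi * (cmod ?a + cmod ?b))) {0..2*pi}"
    by (simp add: algebra_simps)
  have ptw: "cmod (?h t * (cis \<phi> * cis (- (real n * t)) + cis \<psi> * cis (real n * t)))
      \<le> 2 * M * \<bar>cos (real n * t + (\<psi> - \<phi>) / 2)\<bar>" for t
  proof -
    have "cis \<phi> * cis (- (real n * t)) + cis \<psi> * cis (real n * t)
      = cis ((\<phi> + \<psi>) / 2) * (2 * cos (real n * t + (\<psi> - \<phi>) / 2))"
    proof -
      define x where "x = real n * t + (\<psi> - \<phi>) / 2"
      have "\<phi> - real n * t = (\<phi> + \<psi>) / 2 - x" "\<psi> + real n * t = (\<phi> + \<psi>) / 2 + x"
        by (auto simp: x_def field_simps)
      then have "cis \<phi> * cis (- (real n * t)) + cis \<psi> * cis (real n * t) = cis ((\<phi> + \<psi>) / 2) * (cis (- x) + cis x)"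
        by (simp add: cis_mult distrib_left)
      also have "cis (- x) + cis x = 2 * cos x"
        by (simp add: complex_eq_iff)
      finally show ?thesis by (simp add: x_def)
    qed
    then have "cmod (cis \<phi> * cis (- (real n * t)) + cis \<psi> * cis (real n * t)) = 2 * \<bar>cos (real n * t + (\<psi> - \<phi>) / 2)\<bar>"
      by (simp add: norm_mult)
    then show ?thesis
      using mult_right_mono[OF bnd[of "cis t"], of "2 * \<bar>cos (real n * t + (\<psi> - \<phi>) / 2)\<bar>"]
      by (simp add: norm_mult mult_ac)
  qed
  have "cmod (of_real (2 * pi * (cmod ?a + cmod ?b))) \<le> 2 * M * 4"
    using integral_norm_bound_integral[OF has_integral_integrable[OF I]
       has_integral_integrable[OF has_integral_mult_right[OF abs_cos_linear_has_integral[OF n], of "2 * M" "(\<psi> - \<phi>) / 2"]] ptw]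
    unfolding integral_unique[OF I] integral_unique[OF has_integral_mult_right[OF abs_cos_linear_has_integral[OF n], of "2 * M" "(\<psi> - \<phi>) / 2"]]
    by simp
  moreover have "2 * pi * (cmod ?a + cmod ?b) \<le> cmod (of_real (2 * pi * (cmod ?a + cmod ?b)))"
    by (simp only: norm_of_real abs_ge_self)
  ultimately have "2 * pi * (cmod ?a + cmod ?b) \<le> 2 * M * 4"
    by (rule order_trans[rotated])
  then show ?thesis
    by (simp add: field_simps)
qed


section \<open>Solutions with small boundary values\<close>

text \<open>A positive \<open>D\<close> would make \<open>\<phi>'\<close> positive just to the right
  of 0, and \<open>\<phi>\<close> would increase there.\<close>

lemma second_derivative_nonpos_at_max:
  fixes \<phi> :: "real \<Rightarrow> real"
  assumes \<delta>: "\<delta> > 0" and d1: "\<And>t. \<bar>t\<bar> < \<delta> \<Longrightarrow> (\<phi> has_real_derivative \<phi>' t) (at t)"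
    and d2: "(\<phi>' has_real_derivative D) (at 0)" and max: "\<And>t. \<bar>t\<bar> < \<delta> \<Longrightarrow> \<phi> t \<le> \<phi> 0"
  shows "D \<le> 0"
proof (rule ccontr)
  assume "\<not> D \<le> 0"
  then have "D > 0" by simp
  have "\<phi>' 0 = 0"
    using DERIV_local_max[OF d1[of 0] \<delta>] max \<delta> by auto
  obtain d where d: "d > 0" "\<And>h. 0 < h \<Longrightarrow> h < d \<Longrightarrow> 0 < \<phi>' h"
    using DERIV_pos_inc_right[OF d2 \<open>D > 0\<close>] \<open>\<phi>' 0 = 0\<close> by auto
  define h where "h = min d \<delta> / 2"
  have h: "0 < h" "h < d" "h < \<delta>" using d \<delta> by (auto simp: h_def)
  have "\<phi> 0 < \<phi> h"
  proof (rule DERIV_pos_imp_increasing_open[OF h(1)])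
    show "\<exists>y. (\<phi> has_real_derivative y) (at x) \<and> 0 < y" if "0 < x" "x < h" for x
      using that h d d1[of x] by (intro exI[of _ "\<phi>' x"]) auto
    show "continuous_on {0..h} \<phi>"
      using h by (intro continuous_at_imp_continuous_on ballI DERIV_isCont[OF d1]) auto
  qed
  then show False using max[of h] h by simp
qed

text \<open>Comparison with a paraboloid: for the rotation \<open>\<alpha>\<close> that makes
  \<open>\<alpha> * F z\<close> real and nonnegative, \<open>u\<close> has Laplacian at least
  \<open>\<delta> > 0\<close> in the open disk. Its maximum thus sits on the circle, where
  \<open>u\<close> is at most \<open>\<epsilon> + (M + \<delta>) / 4\<close>.\<close>

lemma poisson_max_principle:
  assumes p: "poisson_on (ball 0 1) F P Q g" and cont: "continuous_on (cball 0 1) F"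
    and M: "\<And>w. w \<in> ball 0 1 \<Longrightarrow> cmod (g w) \<le> M"
    and bd: "\<And>w. w \<in> sphere 0 1 \<Longrightarrow> cmod (F w) \<le> \<epsilon>" and z: "z \<in> cball 0 1"
  shows "cmod (F z) \<le> \<epsilon> + M * (1 - (cmod z)\<^sup>2) / 4"
proof (rule field_le_epsilon)
  fix \<delta> :: real assume \<delta>: "\<delta> > 0"
  obtain R1 R2 where w: "wirtinger_on (ball 0 1) F P Q" and wP: "wirtinger_on (ball 0 1) P R1 (\<lambda>z. g z / 4)"
    and wQ: "wirtinger_on (ball 0 1) Q (\<lambda>z. g z / 4) R2"
    using p by (auto simp: poisson_on_def)
  define \<alpha> where "\<alpha> = cis (- Arg (F z))"
  have \<alpha>: "cmod \<alpha> = 1" "\<alpha> * F z = of_real (cmod (F z))"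
    by (simp_all add: \<alpha>_def cis_minus_Arg_mult)
  define u where "u w = Re (\<alpha> * F w) + (M + \<delta>) / 4 * (cmod w)\<^sup>2" for w
  have "continuous_on (cball 0 1) u"
    unfolding u_def by (intro continuous_intros cont)
  then obtain m where m: "m \<in> cball 0 1" "\<And>w. w \<in> cball 0 1 \<Longrightarrow> u w \<le> u m"
    using continuous_attains_sup[of "cball 0 1" u] z by auto
  have "m \<notin> ball 0 1"
  proof
    assume mb: "m \<in> ball 0 1"
    \<comment> \<open>The left side is the second derivative of \<open>u\<close> at \<open>m\<close>
      in the direction \<open>e\<close>.\<close>
    have "Re (\<alpha> * ((R1 m * e + g m / 4 * cnj e) * e + (g m / 4 * e + R2 m * cnj e) * cnj e)) + (M + \<delta>) / 2 \<le> 0"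
      if e: "cmod e = 1" for e
    proof (rule second_derivative_nonpos_at_max)
      let ?\<delta> = "1 - cmod m"
      show "?\<delta> > 0" using mb by simp
      have inb: "m + of_real t * e \<in> ball 0 1" if "\<bar>t\<bar> < ?\<delta>" for t
        using that norm_triangle_ineq[of m "of_real t * e"] e by (simp add: norm_mult)
      have line: "((\<lambda>t. m + of_real t * e) has_vector_derivative e) (at t)" for t
        by (auto intro!: derivative_eq_intros simp: has_vector_derivative_def scaleR_conv_of_real)
      let ?d2 = "\<lambda>t. 2 * ((Re m + t * Re e) * Re e + (Im m + t * Im e) * Im e)"
      show "((\<lambda>t. u (m + of_real t * e)) has_real_derivative
          Re (\<alpha> * (P (m + of_real t * e) * e + Q (m + of_real t * e) * cnj e)) + (M + \<delta>) / 4 * ?d2 t) (at t)"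
        if "\<bar>t\<bar> < ?\<delta>" for t
      proof -
        have "((\<lambda>t. Re (\<alpha> * F (m + of_real t * e))) has_real_derivative
           Re (\<alpha> * (P (m + of_real t * e) * e + Q (m + of_real t * e) * cnj e))) (at t)"
          unfolding has_real_derivative_iff_has_vector_derivative
          by (intro bounded_linear.has_vector_derivative[OF bounded_linear_Re] has_vector_derivative_mult_right
             wirtinger_on_curve[OF w inb[OF that] line])
        moreover have "((\<lambda>t. (M + \<delta>) / 4 * (cmod (m + of_real t * e))\<^sup>2) has_real_derivative (M + \<delta>) / 4 * ?d2 t) (at t)"
          unfolding cmod_power2
          by (rule DERIV_cmult) (auto intro!: derivative_eq_intros simp: algebra_simps)
        ultimately show ?thesis
          unfolding u_def by (rule DERIV_add)
      qed
      have "((\<lambda>t. P (m + of_real t * e) * e + Q (m + of_real t * e) * cnj e) has_vector_derivative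
         (R1 (m + of_real 0 * e) * e + g (m + of_real 0 * e) / 4 * cnj e) * e
         + (g (m + of_real 0 * e) / 4 * e + R2 (m + of_real 0 * e) * cnj e) * cnj e) (at 0)"
        using inb[of 0] mb
        by (intro has_vector_derivative_add has_vector_derivative_mult_left wirtinger_on_curve[OF wP _ line]
            wirtinger_on_curve[OF wQ _ line]) auto
      then have "((\<lambda>t. Re (\<alpha> * (P (m + of_real t * e) * e + Q (m + of_real t * e) * cnj e))) has_real_derivative
         Re (\<alpha> * ((R1 m * e + g m / 4 * cnj e) * e + (g m / 4 * e + R2 m * cnj e) * cnj e))) (at 0)"
        unfolding has_real_derivative_iff_has_vector_derivative
        by (intro bounded_linear.has_vector_derivative[OF bounded_linear_Re] has_vector_derivative_mult_right) simp
      moreover have "((\<lambda>t. (M + \<delta>) / 4 * ?d2 t) has_real_derivative (M + \<delta>) / 2) (at 0)"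
      proof -
        have "(Re e)\<^sup>2 + (Im e)\<^sup>2 = 1" using e cmod_power2[of e] by simp
        then have "(M + \<delta>) / 4 * (2 * (Re e * Re e + Im e * Im e)) = (M + \<delta>) / 2"
          by (simp add: power2_eq_square)
        moreover have "((\<lambda>t. (M + \<delta>) / 4 * ?d2 t) has_real_derivative (M + \<delta>) / 4 * (2 * (Re e * Re e + Im e * Im e))) (at 0)"
          by (rule DERIV_cmult) (auto intro!: derivative_eq_intros)
        ultimately show ?thesis by (simp only:)
      qed
      ultimately show "((\<lambda>t. Re (\<alpha> * (P (m + of_real t * e) * e + Q (m + of_real t * e) * cnj e)) + (M + \<delta>) / 4 * ?d2 t)
          has_real_derivative
          Re (\<alpha> * ((R1 m * e + g m / 4 * cnj e) * e + (g m / 4 * e + R2 m * cnj e) * cnj e)) + (M + \<delta>) / 2) (at 0)"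
        by (rule DERIV_add)
      show "u (m + of_real t * e) \<le> u (m + of_real 0 * e)" if "\<bar>t\<bar> < ?\<delta>" for t
        using m(2)[of "m + of_real t * e"] inb[OF that] by simp
    qed
    note second_order = this
    \<comment> \<open>From direction 1 to direction \<open>\<i>\<close> the pure second derivatives
      change sign and the mixed ones do not, so adding the two inequalities leaves the
      Laplacian.\<close>
    have E1: "\<alpha> * ((R1 m * 1 + g m / 4 * cnj 1) * 1 + (g m / 4 * 1 + R2 m * cnj 1) * cnj 1)
          = \<alpha> * (R1 m + R2 m) + \<alpha> * g m / 2"
      and E2: "\<alpha> * ((R1 m * \<i> + g m / 4 * cnj \<i>) * \<i> + (g m / 4 * \<i> + R2 m * cnj \<i>) * cnj \<i>)
          = - (\<alpha> * (R1 m + R2 m)) + \<alpha> * g m / 2"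
      by (simp_all add: field_simps)
    have "Re (\<alpha> * (R1 m + R2 m)) + Re (\<alpha> * g m / 2) + (M + \<delta>) / 2 \<le> 0"
      "- Re (\<alpha> * (R1 m + R2 m)) + Re (\<alpha> * g m / 2) + (M + \<delta>) / 2 \<le> 0"
      using second_order[of 1, OF norm_one] second_order[of \<i>, OF norm_ii]
      unfolding E1 E2 plus_complex.sel uminus_complex.sel .
    moreover have "Re (\<alpha> * g m / 2) = Re (\<alpha> * g m) / 2"
      by simp
    ultimately have "Re (\<alpha> * g m) + M + \<delta> \<le> 0"
      by argo
    moreover have "\<bar>Re (\<alpha> * g m)\<bar> \<le> M"
      using abs_Re_le_cmod[of "\<alpha> * g m"] M[OF mb] \<alpha> by (simp add: norm_mult)
    ultimately show False using \<delta> by linarith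
  qed
  then have ms: "m \<in> sphere 0 1" using m(1) by auto
  have "cmod (F z) + (M + \<delta>) / 4 * (cmod z)\<^sup>2 = u z"
    using \<alpha> by (simp add: u_def)
  also have "\<dots> \<le> u m" using m(2)[OF z] .
  also have "\<dots> \<le> \<epsilon> + (M + \<delta>) / 4"
    using bd[OF ms] abs_Re_le_cmod[of "\<alpha> * F m"] ms \<alpha> by (simp add: u_def norm_mult)
  finally have "cmod (F z) \<le> \<epsilon> + M * (1 - (cmod z)\<^sup>2) / 4 + \<delta> * (1 - (cmod z)\<^sup>2) / 4"
    by (simp add: field_simps)
  also have "\<delta> * (1 - (cmod z)\<^sup>2) / 4 \<le> \<delta>"
    using \<delta> zero_le_power2[of "cmod z"] by (simp add: field_simps)
  finally show "cmod (F z) \<le> \<epsilon> + M * (1 - (cmod z)\<^sup>2) / 4 + \<delta>" by simp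
qed

text \<open>Boundary values enter only through \<open>v_bound\<close>, and the assumptions are
  invariant under conjugation, so every estimate for \<open>P\<close> transfers to
  \<open>Q\<close>.\<close>

locale green_part =
  fixes v P Q g :: "complex \<Rightarrow> complex" and M \<epsilon> :: real
  assumes poisson: "poisson_on (ball 0 1) v P Q g"
    and g_bound: "\<And>w. w \<in> ball 0 1 \<Longrightarrow> cmod (g w) \<le> M"
    and v_bound: "\<And>w. w \<in> ball 0 1 \<Longrightarrow> cmod (v w) \<le> \<epsilon> + M * (1 - (cmod w)\<^sup>2) / 4"
begin

text \<open>The gradient estimate is applied on circles of radius \<open>s\<close> about 0. As
  \<open>s\<close> tends to 1 the quadratic part of \<open>v_bound\<close> vanishes and
  \<open>\<epsilon> + M / 3\<close> remains.\<close>

lemma norm_P_0: "cmod (P 0) \<le> \<epsilon> + M / 3"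
proof -
  have "cmod (P 0) \<le> (\<epsilon> + M * (1 - s\<^sup>2) / 4) / s + M * s / 3" if s: "0 < s" "s < 1" for s
  proof (rule norm_gradient_le[OF poisson g_bound])
    show "cmod (v (0 + of_real s * cis t)) \<le> \<epsilon> + M * (1 - s\<^sup>2) / 4" for t
      using v_bound[of "of_real s * cis t"] s by (simp add: norm_mult)
  qed (use s in auto)
  then have "eventually (\<lambda>s. cmod (P 0) \<le> (\<epsilon> + M * (1 - s\<^sup>2) / 4) / s + M * s / 3) (at_left 1)"
    using eventually_at_left_real[of 0 1] by (auto elim!: eventually_mono)
  moreover have "((\<lambda>s. (\<epsilon> + M * (1 - s\<^sup>2) / 4) / s + M * s / 3) \<longlongrightarrow> (\<epsilon> + M * (1 - 1\<^sup>2) / 4) / 1 + M * 1 / 3) (at_left (1::real))"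
    by (intro tendsto_intros) auto
  ultimately show ?thesis
    using tendsto_lowerbound[of "\<lambda>s. (\<epsilon> + M * (1 - s\<^sup>2) / 4) / s + M * s / 3" _ "at_left 1" "cmod (P 0)"] by simp
qed

lemma M_nonneg: "0 \<le> M"
  by (rule order_trans[OF norm_ge_zero g_bound[of 0]]) simp

text \<open>A crude bound from circles of radius \<open>1 / 4\<close>, which fit because
  \<open>2 / 3 + 1 / 4 < 1\<close>; the constant is
  \<open>4 * (\<epsilon> + M / 4) + M / 12\<close>.\<close>

lemma norm_P_inner:
  assumes w: "cmod w \<le> 2 / 3"
  shows "cmod (P w) \<le> 4 * \<epsilon> + 13 / 12 * M"
proof -
  have sub: "cball w (1 / 4) \<subseteq> ball 0 1"
  proof
    fix y assume "y \<in> cball w (1 / 4)"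
    then show "y \<in> ball 0 1"
      using w norm_triangle_ineq[of w "y - w"] by (simp add: dist_norm norm_minus_commute)
  qed
  have "cmod (P w) \<le> (\<epsilon> + M / 4) / (1 / 4) + M * (1 / 4) / 3"
  proof (rule norm_gradient_le[OF poisson g_bound _ sub])
    fix t
    have "w + of_real (1 / 4) * cis t \<in> ball 0 1"
      using sub circle_in_cball[of "1 / 4" "1 / 4" w t] by auto
    from v_bound[OF this] show "cmod (v (w + of_real (1 / 4) * cis t)) \<le> \<epsilon> + M / 4"
      using mult_left_mono[OF _ M_nonneg, of "1 - (cmod (w + of_real (1 / 4) * cis t))\<^sup>2" 1] by simp
  qed auto
  then show ?thesis by simp
qed

text \<open>\<open>P z\<close> and \<open>P 0\<close> are replaced by circle means of radius
  \<open>cmod z\<close>, at a cost of \<open>M * cmod z / 3\<close> each, and the translation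
  estimate compares the two means.\<close>

lemma norm_P_diff:
  assumes z: "z \<noteq> 0" "cmod z \<le> 1 / 3"
  shows "cmod (P z - P 0) \<le> cmod z * (M * (25 / 6 + ln (1 / (3 * cmod z)) / 2) + 12 * \<epsilon>)"
proof -
  obtain R1 R2 where w: "wirtinger_on (ball 0 1) v P Q" and wP: "wirtinger_on (ball 0 1) P R1 (\<lambda>z. g z / 4)"
    and wQ: "wirtinger_on (ball 0 1) Q (\<lambda>z. g z / 4) R2"
    using poisson by (auto simp: poisson_on_def)
  define r where "r = cmod z"
  have r: "0 < r" "r \<le> 1 / 3" using z by (auto simp: r_def)
  \<comment> \<open>Circles of radius at most \<open>1 / 3\<close> about points of the segment from
    0 to \<open>z\<close> stay where \<open>norm_P_inner\<close> applies.\<close>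
  have near: "cmod y \<le> 2 / 3" if "t \<in> {0..1}" "y \<in> cball (of_real t * z) \<rho>" "\<rho> \<le> 1 / 3" for t y \<rho>
  proof -
    have "cmod (of_real t * z) \<le> 1 / 3"
      using that(1) r mult_mono[of t 1 "cmod z" "1/3"] by (simp add: norm_mult r_def)
    then show ?thesis
      using that norm_triangle_ineq[of "of_real t * z" "y - of_real t * z"] by (simp add: dist_norm norm_minus_commute)
  qed
  have sub: "cball (of_real t * z) \<rho> \<subseteq> ball 0 1" if "t \<in> {0..1}" "\<rho> \<le> 1 / 3" for t \<rho>
    using near[OF that(1) _ that(2)] by fastforce
  \<comment> \<open>The first two summands come from \<open>P\<close> with outer radius
    \<open>1 / 3\<close>, the last one from \<open>Q\<close>, whose \<open>z\<close>-derivative is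
    \<open>g / 4\<close>.\<close>
  let ?B = "r * (pi * (6 * (4 * \<epsilon> + 13 / 12 * M) + M * ln (1 / (3 * r)) + M / 2))"
  have "cmod (circle_coeff 1 v z r - circle_coeff 1 v 0 r) \<le> cmod z * ?B"
  proof (rule norm_circle_coeff_translate_le[OF w])
    fix t :: real assume t: "t \<in> {0..1}"
    show "cball (of_real t * z) r \<subseteq> ball 0 1" using sub[OF t r(2)] .
    have "cmod (circle_coeff 1 P (of_real t * z) r) \<le> r * (2 * pi * (4 * \<epsilon> + 13 / 12 * M) / (1 / 3) + pi * M * ln (1 / 3 / r))"
      using norm_P_inner near[OF t, of _ "1 / 3"]
      by (intro norm_circle_mean_second_derivative[OF wP g_bound _ sub[OF t]] r) auto
    moreover have "cmod (circle_coeff (int 1) Q (of_real t * z) r) \<le> 4 * pi * (M / 4) * r / (1 + 1)"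
      using r norm_circle_coeff_le_radius[OF wQ sub[OF t r(2)], of 1 "M / 4"] g_bound by (auto simp: norm_divide)
    ultimately show "cmod (circle_coeff 1 P (of_real t * z) r) + cmod (circle_coeff 1 Q (of_real t * z) r) \<le> ?B"
      by (simp add: field_simps)
  qed (use r in auto)
  then have diff: "cmod (circle_coeff 1 v z r / of_real r - circle_coeff 1 v 0 r / of_real r) \<le> ?B"
    using r by (simp add: norm_divide field_simps flip: diff_divide_distrib r_def)
  have "cmod (circle_coeff 1 v z r / of_real r - of_real (2 * pi) * P z) \<le> 2 * pi * M * r / 3"
    using circle_mean_gradient[OF poisson g_bound, of z r] sub[of 1 r] r by auto
  moreover have "cmod (circle_coeff 1 v 0 r / of_real r - of_real (2 * pi) * P 0) \<le> 2 * pi * M * r / 3"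
    using circle_mean_gradient[OF poisson g_bound, of 0 r] sub[of 0 r] r by auto
  ultimately have "cmod (of_real (2 * pi) * P z - of_real (2 * pi) * P 0) \<le> 2 * (2 * pi * M * r / 3) + ?B"
    using diff by (smt (verit) norm_triangle_ineq4 norm_minus_commute norm_diff_triangle_le norm_triangle_sub)
  \<comment> \<open>The constant is \<open>25 / 6 = 2 / 3 + 13 / 4 + 1 / 4\<close>: the two mean
    errors, the inner bound on \<open>P\<close>, and the share of \<open>Q\<close>.\<close>
  then have "2 * pi * cmod (P z - P 0) \<le> 2 * pi * (r * (M * (25 / 6 + ln (1 / (3 * r)) / 2) + 12 * \<epsilon>))"
    unfolding right_diff_distrib[symmetric] norm_mult by (simp add: field_simps)
  then show ?thesis by (simp add: r_def)
qed

end

lemma green_part_cnj: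
  assumes "green_part v P Q g M \<epsilon>"
  shows "green_part (\<lambda>z. cnj (v z)) (\<lambda>z. cnj (Q z)) (\<lambda>z. cnj (P z)) (\<lambda>z. cnj (g z)) M \<epsilon>"
  using assms unfolding green_part_def by (simp add: poisson_on_cnj)


section \<open>Twice continuously differentiable functions\<close>

text \<open>The real derivative is determined by its values at 1 and \<open>\<i>\<close>, which are
  the partial derivatives; expressing it through \<open>h\<close> and \<open>cnj h\<close> produces
  the Wirtinger derivatives.\<close>

lemma C1_on_wirtinger:
  assumes "open S" "C1_on S f"
  shows "wirtinger_on S f (wirtinger_z f) (wirtinger_zbar f)"
proof -
  have "(f has_derivative (\<lambda>h. wirtinger_z f z * h + wirtinger_zbar f z * cnj h)) (at z)" if z: "z \<in> S" for z
  proof -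
    have "f differentiable (at z)"
      using assms z by (auto simp: C1_on_def differentiable_on_eq_differentiable_at)
    then obtain D where D: "(f has_derivative D) (at z)" by (auto simp: differentiable_def)
    then interpret D: linear D by (rule has_derivative_linear)
    have dir: "((\<lambda>t. f (z + e * of_real t)) has_vector_derivative D e) (at 0)" for e
    proof -
      have "((\<lambda>t. z + e * of_real t) has_derivative (\<lambda>h. h *\<^sub>R e)) (at (0::real))"
        by (auto intro!: derivative_eq_intros simp: scaleR_conv_of_real)
      from has_derivative_compose[OF this, of f D] D
      show ?thesis by (simp add: has_vector_derivative_def D.scale)
    qed
    have "partial_x f z = D 1" "partial_y f z = D \<i>"
      using vector_derivative_at[OF dir[of 1]] vector_derivative_at[OF dir[of \<i>]]
      by (simp_all add: partial_x_def partial_y_def)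
    moreover have "D h = of_real (Re h) * D 1 + of_real (Im h) * D \<i>" for h
    proof -
      have "h = Re h *\<^sub>R 1 + Im h *\<^sub>R \<i>" by (simp add: complex_eq_iff)
      then have "D h = D (Re h *\<^sub>R 1 + Im h *\<^sub>R \<i>)" by simp
      then show ?thesis by (simp only: D.add D.scale) (simp only: scaleR_conv_of_real)
    qed
    moreover have "of_real (Re h) * X + of_real (Im h) * Y = (X - \<i> * Y) / 2 * h + (X + \<i> * Y) / 2 * cnj h" for X Y h
      by (simp add: complex_eq_iff field_simps)
    ultimately have "D = (\<lambda>h. wirtinger_z f z * h + wirtinger_zbar f z * cnj h)"
      unfolding wirtinger_z_def wirtinger_zbar_def by (intro ext) metis
    then show ?thesis using D by simp
  qed
  moreover have "continuous_on S (wirtinger_z f)" "continuous_on S (wirtinger_zbar f)"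
    unfolding wirtinger_z_def[abs_def] wirtinger_zbar_def[abs_def]
    using assms(2) by (auto simp: C1_on_def intro!: continuous_intros)
  ultimately show ?thesis by (simp add: wirtinger_on_def)
qed

lemma partial_curve:
  assumes "open S" "C1_on S f" "\<gamma> x \<in> S" "(\<gamma> has_vector_derivative d) (at x within T)"
  shows "((\<lambda>x. f (\<gamma> x)) has_vector_derivative (of_real (Re d) * partial_x f (\<gamma> x) + of_real (Im d) * partial_y f (\<gamma> x))) (at x within T)"
  by (rule has_vector_derivative_eq_rhs[OF wirtinger_on_curve[where \<gamma> = \<gamma>, OF C1_on_wirtinger[OF assms(1,2)] assms(3,4)]])
     (simp add: wirtinger_z_def wirtinger_zbar_def complex_eq_iff field_simps)

text \<open>Schwarz's theorem: \<open>f (p x y) - f (p 0 y)\<close> is an integral of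
  \<open>partial_x f\<close>. Differentiating it at 0, first in \<open>y\<close> under the integral
  sign and then in \<open>x\<close>, yields both orders of differentiation.\<close>

lemma C2_on_mixed_partials:
  assumes S: "open S" and f: "C2_on S f" and z: "z \<in> S"
  shows "partial_y (partial_x f) z = partial_x (partial_y f) z"
proof -
  have C: "C1_on S f" "C1_on S (partial_x f)" "C1_on S (partial_y f)"
    using f by (auto simp: C2_on_def)
  have cx: "continuous_on S (partial_x f)" and cxy: "continuous_on S (partial_y (partial_x f))"
    using C by (auto simp: C1_on_def)
  obtain \<rho> where \<rho>: "\<rho> > 0" "cball z \<rho> \<subseteq> S" using S z open_contains_cball by blast
  \<comment> \<open>Half the radius, so that points of the square of side \<open>d\<close> lie
    within \<open>\<bar>x\<bar> + \<bar>y\<bar> \<le> \<rho>\<close> of \<open>z\<close>.\<close>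
  define d where "d = \<rho> / 2"
  have d: "d > 0" using \<rho> by (simp add: d_def)
  define p where "p x y = z + of_real x + \<i> * of_real y" for x y :: real
  have inS: "p x y \<in> S" if "x \<in> {0..d}" "y \<in> {0..d}" for x y
  proof -
    have "cmod (of_real x + \<i> * of_real y) \<le> \<bar>x\<bar> + \<bar>y\<bar>"
      by (rule order_trans[OF norm_triangle_ineq]) (simp add: norm_mult)
    moreover have "dist (p x y) z = cmod (of_real x + \<i> * of_real y)"
      by (simp add: p_def dist_norm)
    ultimately have "p x y \<in> cball z \<rho>"
      using that by (auto simp: dist_commute[of z] d_def)
    then show ?thesis using \<rho> by auto
  qed
  have px: "((\<lambda>x. p x y) has_vector_derivative 1) (at x within T)"
    and py: "((\<lambda>y. p x y) has_vector_derivative \<i>) (at y within T)" for x y T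
    by (auto intro!: derivative_eq_intros simp: p_def has_vector_derivative_def scaleR_conv_of_real)
  have cp: "continuous_on T (\<lambda>w. p (h w) (k w))" if "continuous_on T h" "continuous_on T k"
    for T :: "'a::topological_space set" and h k
    unfolding p_def using that by (intro continuous_intros)
  have ftc: "integral {0..x} (\<lambda>s. partial_x f (p s y)) = f (p x y) - f (p 0 y)"
    if "x \<in> {0..d}" "y \<in> {0..d}" for x y
  proof (rule integral_unique, rule fundamental_theorem_of_calculus)
    fix s assume "s \<in> {0..x}"
    then have "s \<in> {0..d}" using that by auto
    from partial_curve[where \<gamma> = "\<lambda>s. p s y", OF S C(1) inS[OF this that(2)] px]
    show "((\<lambda>s. f (p s y)) has_vector_derivative partial_x f (p s y)) (at s within {0..x})"
      by simp
  qed (use that in auto)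
  \<comment> \<open>Both sides are the one-sided \<open>y\<close>-derivative at 0 of the same
    increment.\<close>
  have eq: "partial_y f (p x 0) - partial_y f (p 0 0) = integral {0..x} (\<lambda>s. partial_y (partial_x f) (p s 0))"
    if x: "x \<in> {0..d}" for x
  proof -
    have 1: "((\<lambda>y. f (p x y) - f (p 0 y)) has_vector_derivative (partial_y f (p x 0) - partial_y f (p 0 0))) (at 0 within {0..d})"
      using partial_curve[where \<gamma> = "\<lambda>y. p x y" and T = "{0..d}", OF S C(1) inS[of x 0] py]
        partial_curve[where \<gamma> = "\<lambda>y. p 0 y" and T = "{0..d}", OF S C(1) inS[of 0 0] py] x d
      by (intro has_vector_derivative_diff) auto
    have "((\<lambda>y. integral (cbox 0 x) (\<lambda>s. partial_x f (p s y))) has_vector_derivative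
       integral (cbox 0 x) (\<lambda>s. partial_y (partial_x f) (p s 0))) (at 0 within {0..d})"
    proof (rule leibniz_rule_vector_derivative)
      fix y s assume y: "y \<in> {0..d}" and s: "s \<in> cbox 0 x"
      then have "s \<in> {0..d}" using x by auto
      from partial_curve[where \<gamma> = "\<lambda>y. p s y", OF S C(2) inS[OF this y] py]
      show "((\<lambda>y. partial_x f (p s y)) has_vector_derivative partial_y (partial_x f) (p s y)) (at y within {0..d})"
        by simp
    next
      fix y assume y: "y \<in> {0..d}"
      show "(\<lambda>s. partial_x f (p s y)) integrable_on cbox 0 x"
        using x y by (intro integrable_continuous continuous_on_compose2[OF cx] cp continuous_intros) (auto intro!: inS)
    next
      show "continuous_on ({0..d} \<times> cbox 0 x) (\<lambda>(y, s). partial_y (partial_x f) (p s y))"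
        unfolding split_beta using x
        by (intro continuous_on_compose2[OF cxy] cp continuous_intros) (auto intro!: inS)
    qed (use d in auto)
    then have 2: "((\<lambda>y. integral {0..x} (\<lambda>s. partial_x f (p s y))) has_vector_derivative
       integral {0..x} (\<lambda>s. partial_y (partial_x f) (p s 0))) (at 0 within {0..d})"
      by simp
    have 3: "((\<lambda>y. f (p x y) - f (p 0 y)) has_vector_derivative
       integral {0..x} (\<lambda>s. partial_y (partial_x f) (p s 0))) (at 0 within {0..d})"
      by (rule has_vector_derivative_transform[OF _ _ 2]) (use d ftc[OF x] in auto)
    show ?thesis
      using vector_derivative_unique_within_closed_interval[of 0 d 0, OF _ _ 1[folded cbox_interval] 3[folded cbox_interval]] d by simp
  qed
  have 4: "((\<lambda>x. integral {0..x} (\<lambda>s. partial_y (partial_x f) (p s 0))) has_vector_derivative partial_y (partial_x f) (p 0 0)) (at 0 within {0..d})"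
    using d by (intro integral_has_vector_derivative continuous_on_compose2[OF cxy] cp continuous_intros) (auto intro!: inS)
  have 5: "((\<lambda>x. partial_y f (p x 0) - partial_y f (p 0 0)) has_vector_derivative partial_x (partial_y f) (p 0 0)) (at 0 within {0..d})"
    using partial_curve[where \<gamma> = "\<lambda>x. p x 0" and T = "{0..d}", OF S C(3) inS[of 0 0] px] d
      has_vector_derivative_diff[OF _ has_vector_derivative_const[of "partial_y f (p 0 0)"]] by fastforce
  have 6: "((\<lambda>x. partial_y f (p x 0) - partial_y f (p 0 0)) has_vector_derivative partial_y (partial_x f) (p 0 0)) (at 0 within {0..d})"
    by (rule has_vector_derivative_transform[OF _ _ 4]) (use d eq in auto)
  have "partial_y (partial_x f) (p 0 0) = partial_x (partial_y f) (p 0 0)"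
    using vector_derivative_unique_within_closed_interval[of 0 d 0, OF _ _ 6[folded cbox_interval] 5[folded cbox_interval]] d by simp
  then show ?thesis by (simp add: p_def)
qed

text \<open>In either order the mixed Wirtinger derivative is a quarter of the Laplacian, since the
  cross terms cancel by symmetry of the second partial derivatives.\<close>

lemma C2_on_poisson:
  assumes S: "open S" and f: "C2_on S f" and lap: "\<And>z. z \<in> S \<Longrightarrow> laplacian f z = g z"
  shows "poisson_on S f (wirtinger_z f) (wirtinger_zbar f) g"
proof -
  have C: "C1_on S f" "C1_on S (partial_x f)" "C1_on S (partial_y f)"
    using f by (auto simp: C2_on_def)
  note w = C1_on_wirtinger[OF S]
  have eq: "wirtinger_z f = (\<lambda>z. 1 / 2 * partial_x f z + (- \<i> / 2) * partial_y f z)"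
    "wirtinger_zbar f = (\<lambda>z. 1 / 2 * partial_x f z + (\<i> / 2) * partial_y f z)"
    by (auto simp: wirtinger_z_def wirtinger_zbar_def field_simps)
  have mixed: "1 / 2 * wirtinger_zbar (partial_x f) z + (- \<i> / 2) * wirtinger_zbar (partial_y f) z = g z / 4"
    "1 / 2 * wirtinger_z (partial_x f) z + (\<i> / 2) * wirtinger_z (partial_y f) z = g z / 4" if "z \<in> S" for z
    unfolding lap[OF that, symmetric] laplacian_def wirtinger_z_def wirtinger_zbar_def
      C2_on_mixed_partials[OF S f that]
    by (simp_all add: field_simps)
  have "wirtinger_on S (wirtinger_z f) (\<lambda>z. 1 / 2 * wirtinger_z (partial_x f) z + (- \<i> / 2) * wirtinger_z (partial_y f) z) (\<lambda>z. g z / 4)"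
    unfolding eq by (rule wirtinger_on_cong[OF wirtinger_on_add[OF wirtinger_on_cmult[OF w[OF C(2)]] wirtinger_on_cmult[OF w[OF C(3)]]]])
      (rule refl, erule mixed(1))
  moreover have "wirtinger_on S (wirtinger_zbar f) (\<lambda>z. g z / 4) (\<lambda>z. 1 / 2 * wirtinger_zbar (partial_x f) z + (\<i> / 2) * wirtinger_zbar (partial_y f) z)"
    unfolding eq by (rule wirtinger_on_cong[OF wirtinger_on_add[OF wirtinger_on_cmult[OF w[OF C(2)]] wirtinger_on_cmult[OF w[OF C(3)]]]])
      (erule mixed(2), rule refl)
  ultimately show ?thesis
    using w[OF C(1)] unfolding poisson_on_def by blast
qed

text \<open>The mixed Wirtinger derivative of \<open>A + cnj B\<close> is 0, so the source
  \<open>g\<close> is unchanged.\<close>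

lemma poisson_on_diff_harmonic_poly:
  assumes "poisson_on S F P Q g"
  shows "poisson_on S (\<lambda>z. F z - (poly A z + cnj (poly B z))) (\<lambda>z. P z - poly (pderiv A) z)
     (\<lambda>z. Q z - cnj (poly (pderiv B) z)) g"
proof -
  obtain R1 R2 where w: "wirtinger_on S F P Q" "wirtinger_on S P R1 (\<lambda>z. g z / 4)"
    "wirtinger_on S Q (\<lambda>z. g z / 4) R2"
    using assms by (auto simp: poisson_on_def)
  have "wirtinger_on S (\<lambda>z. F z - (poly A z + cnj (poly B z))) (\<lambda>z. P z - poly (pderiv A) z) (\<lambda>z. Q z - cnj (poly (pderiv B) z))"
    by (rule wirtinger_on_cong[OF wirtinger_on_diff[OF w(1) wirtinger_on_add[OF wirtinger_on_poly wirtinger_on_cnj[OF wirtinger_on_poly]]]]) auto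
  moreover have "wirtinger_on S (\<lambda>z. P z - poly (pderiv A) z) (\<lambda>z. R1 z - poly (pderiv (pderiv A)) z) (\<lambda>z. g z / 4)"
    by (rule wirtinger_on_cong[OF wirtinger_on_diff[OF w(2) wirtinger_on_poly]]) auto
  moreover have "wirtinger_on S (\<lambda>z. Q z - cnj (poly (pderiv B) z)) (\<lambda>z. g z / 4) (\<lambda>z. R2 z - cnj (poly (pderiv (pderiv B)) z))"
    by (rule wirtinger_on_cong[OF wirtinger_on_diff[OF w(3) wirtinger_on_cnj[OF wirtinger_on_poly]]]) auto
  ultimately show ?thesis unfolding poisson_on_def by blast
qed


section \<open>Derivative bounds and Landau's argument\<close>

lemma poly_sum_upto:
  fixes p :: "'a::comm_ring_1 poly"
  assumes "degree p \<le> N"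
  shows "poly p z = (\<Sum>k\<le>N. coeff p k * z ^ k)"
  unfolding poly_altdef
  by (rule sum.mono_neutral_left) (use assms in \<open>auto intro: le_degree\<close>)

text \<open>The constant terms of the derivatives cancel, and the coefficient bound reduces the rest
  to the series of \<open>(k + 1) * r ^ k\<close> over \<open>k \<ge> 1\<close>, which sums to
  \<open>1 / (1 - r)\<^sup>2 - 1\<close>.\<close>

lemma harmonic_poly_deriv_diff:
  fixes A B :: "complex poly"
  assumes bnd: "\<And>z. z \<in> sphere 0 1 \<Longrightarrow> cmod (poly A z + cnj (poly B z)) \<le> M" and z: "cmod z < 1"
  shows "cmod (poly (pderiv A) z - poly (pderiv A) 0) + cmod (poly (pderiv B) z - poly (pderiv B) 0)
     \<le> 4 * M / pi * (cmod z * (2 - cmod z) / (1 - cmod z)\<^sup>2)"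
proof -
  define N where "N = max (degree (pderiv A)) (degree (pderiv B))"
  define r where "r = cmod z"
  have r: "0 \<le> r" "r < 1" using z by (auto simp: r_def)
  have M: "0 \<le> 4 * M / pi"
    using order_trans[OF norm_ge_zero bnd[of 1]] by simp
  have diff: "cmod (poly (pderiv p) z - poly (pderiv p) 0) \<le> (\<Sum>k=1..N. Suc k * cmod (coeff p (Suc k)) * r ^ k)"
    if "degree (pderiv p) \<le> N" for p
  proof -
    have "poly (pderiv p) z = coeff (pderiv p) 0 + (\<Sum>k=1..N. coeff (pderiv p) k * z ^ k)"
      by (simp add: poly_sum_upto[OF that] atMost_atLeast0 sum.atLeast_Suc_atMost)
    then have "poly (pderiv p) z - poly (pderiv p) 0 = (\<Sum>k=1..N. coeff (pderiv p) k * z ^ k)"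
      by (simp add: poly_0_coeff_0)
    also have "cmod \<dots> \<le> (\<Sum>k=1..N. cmod (coeff (pderiv p) k * z ^ k))"
      by (rule norm_sum)
    finally show ?thesis
      by (simp add: coeff_pderiv norm_mult norm_power r_def flip: of_nat_Suc del: of_nat_Suc)
  qed
  have "cmod (poly (pderiv A) z - poly (pderiv A) 0) + cmod (poly (pderiv B) z - poly (pderiv B) 0)
     \<le> (\<Sum>k=1..N. Suc k * (cmod (coeff A (Suc k)) + cmod (coeff B (Suc k))) * r ^ k)"
    using add_mono[OF diff[of A] diff[of B]] by (simp add: N_def sum.distrib algebra_simps)
  also have "\<dots> \<le> (\<Sum>k=1..N. Suc k * (4 * M / pi) * r ^ k)"
    using r harmonic_poly_coeff_bound[OF bnd] by (intro sum_mono mult_right_mono mult_left_mono) auto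
  also have "\<dots> = 4 * M / pi * (\<Sum>k=1..N. Suc k * r ^ k)"
    by (simp add: sum_distrib_left mult_ac)
  finally have bound: "cmod (poly (pderiv A) z - poly (pderiv A) 0) + cmod (poly (pderiv B) z - poly (pderiv B) 0)
     \<le> 4 * M / pi * (\<Sum>k=1..N. Suc k * r ^ k)" .
  have "(\<Sum>k=1..N. Suc k * r ^ k) \<le> r * (2 - r) / (1 - r)\<^sup>2"
  proof -
    have "(\<Sum>k=1..N. Suc k * r ^ k) = (\<Sum>k\<le>N. Suc k * r ^ k) - 1"
      by (simp add: atMost_atLeast0 sum.atLeast_Suc_atMost)
    also have "(\<Sum>k\<le>N. Suc k * r ^ k) \<le> 1 / (1 - r)\<^sup>2"
      using geometric_deriv_sums[of r] r
      by (intro sum_le_suminf[THEN order_trans, OF sums_summable _ _ eq_refl[OF sums_unique[symmetric]]]) auto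
    also have "1 / (1 - r)\<^sup>2 - 1 = r * (2 - r) / (1 - r)\<^sup>2"
    proof -
      have "r * (2 - r) = 1 - (1 - r)\<^sup>2" by (simp add: power2_eq_square algebra_simps)
      then show ?thesis using r by (simp add: diff_divide_distrib)
    qed
    finally show ?thesis by simp
  qed
  from order_trans[OF bound mult_left_mono[OF this M]] show ?thesis
    unfolding r_def .
qed

section \<open>Elementary estimates for the logarithmic term\<close>

lemma ln_4_mult_div_ge_1:
  assumes "0 < (x::real)"
  shows "1 \<le> ln (4 * (1 + x)) - ln x"
proof -
  have "1 \<le> ln (4 :: real)" using exp_le by (simp add: ln_ge_iff)
  also have "ln (4 :: real) \<le> ln (4 * (1 + x) / x)"
    using assms by (intro ln_mono) (auto simp: field_simps)
  also have "\<dots> = ln (4 * (1 + x)) - ln x" using assms by (subst ln_div) auto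
  finally show ?thesis .
qed

text \<open>The logarithmic factor itself decreases. Its derivative contributes only
  \<open>- 2 * (2 + x) / (1 + x)\<close>, which is absorbed because that factor is at least
  1.\<close>

lemma log_term_mono:
  fixes s t :: real
  assumes "0 < s" "s \<le> t"
  shows "2 * (ln (4 * (1 + s)) - ln s) * (2 + s) * s \<le> 2 * (ln (4 * (1 + t)) - ln t) * (2 + t) * t"
proof (rule DERIV_nonneg_imp_nondecreasing[OF assms(2)])
  fix x assume "s \<le> x" "x \<le> t"
  then have x: "x > 0" using assms by simp
  let ?D = "2 * (ln (4 * (1 + x)) - ln x) * (2 + 2 * x) - 2 * (2 + x) / (1 + x)"
  have "((\<lambda>x. 2 * (ln (4 * (1 + x)) - ln x) * (2 + x) * x) has_real_derivative ?D) (at x)"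
  proof -
    define l where "l = (\<lambda>x :: real. ln (4 * (1 + x)) - ln x)"
    have "(l has_real_derivative (1 / (1 + x) - 1 / x)) (at x)"
      unfolding l_def using x by (auto intro!: derivative_eq_intros simp: divide_simps)
    then have "((\<lambda>x. 2 * l x * (2 + x) * x) has_real_derivative
        (2 * (1 / (1 + x) - 1 / x) * (2 + x) + 2 * l x) * x + 2 * l x * (2 + x)) (at x)"
      by (auto intro!: derivative_eq_intros)
    moreover have "(2 * (1 / (1 + x) - 1 / x) * (2 + x) + 2 * l x) * x + 2 * l x * (2 + x)
        = 2 * l x * (2 + 2 * x) - 2 * (2 + x) / (1 + x)"
    proof -
      have "(1 / (1 + x) - 1 / x) * x = - (1 / (1 + x))"
        using x add_pos_pos[OF x mult_pos_pos[OF x x]] by (simp add: field_simps)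
      then have "2 * l x * (2 + 2 * x) - 2 * (2 + x) / (1 + x)
          = 2 * ((1 / (1 + x) - 1 / x) * x) * (2 + x) + 2 * l x * (2 + 2 * x)"
        by simp
      also have "\<dots> = (2 * (1 / (1 + x) - 1 / x) * (2 + x) + 2 * l x) * x + 2 * l x * (2 + x)"
        by (simp only: distrib_right distrib_left mult_ac)
      finally show ?thesis by simp
    qed
    ultimately show ?thesis by (simp only: l_def)
  qed
  moreover have "2 * (2 + x) / (1 + x) \<le> 2 * (ln (4 * (1 + x)) - ln x) * (2 + 2 * x)"
  proof -
    have "2 * (2 + x) / (1 + x) \<le> 2 * 1 * (2 + 2 * x)"
      using x by (simp add: field_simps)
    also have "\<dots> \<le> 2 * (ln (4 * (1 + x)) - ln x) * (2 + 2 * x)"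
      using ln_4_mult_div_ge_1[OF x] x by (intro mult_right_mono mult_left_mono) auto
    finally show ?thesis .
  qed
  ultimately show "\<exists>y. ((\<lambda>x. 2 * (ln (4 * (1 + x)) - ln x) * (2 + x) * x) has_real_derivative y) (at x) \<and> 0 \<le> y"
    by (intro exI[of _ ?D]) auto
qed

text \<open>Compares the modulus of continuity from the remainder, doubled to cover both Wirtinger
  derivatives, with the term in the equation for \<open>r0\<close>. By
  \<open>ln 3 \<le> - ln r\<close> it comes down to \<open>25 / 12 \<le> ln 12\<close>.\<close>

lemma green_modulus_le_log_term:
  assumes r: "0 < r" "r \<le> (1 / 3 :: real)"
  shows "2 * r * (25 / 6 + ln (1 / (3 * r)) / 2) \<le> 2 * (ln (4 * (1 + r)) - ln r) * (2 + r) * r"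
proof -
  \<comment> \<open>\<open>25 / 12 \<le> ln 12\<close> in the form
    \<open>exp 25 \<le> 12 ^ 12\<close>; the bound \<open>exp 1 \<le> 3\<close> makes it a
    comparison of integers.\<close>
  have "exp (25 :: real) = exp 1 ^ 25" by (simp flip: exp_of_nat_mult)
  also have "\<dots> \<le> 3 ^ 25" by (rule power_mono[OF exp_le]) simp
  also have "\<dots> \<le> (12 :: real) ^ 12" by simp
  finally have "25 \<le> ln ((12 :: real) ^ 12)" by (simp add: ln_ge_iff)
  then have "25 / 12 \<le> ln (12 :: real)" using ln_realpow[of "12 :: real" 12] by simp
  also have "ln (12 :: real) = ln 4 + ln 3" using ln_mult[of 4 "3::real"] by simp
  finally have num: "25 / 12 \<le> ln 4 + ln (3 :: real)" .
  have "ln r \<le> ln (1 / 3)" using r by (intro ln_mono) auto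
  then have L: "ln 3 \<le> - ln r" by (simp add: ln_div)
  have L0: "0 \<le> ln (3 :: real)" "0 \<le> ln (4 :: real)" "0 \<le> ln (1 + r)" using r by auto
  have "25 / 6 + ln (1 / (3 * r)) / 2 = 25 / 6 - ln 3 / 2 - ln r / 2"
    using r by (simp add: ln_div ln_mult)
  also have "\<dots> \<le> 2 * (ln 4 - ln r)"
    using num L by (simp add: field_simps)
  also have "\<dots> \<le> (2 + r) * (ln 4 + ln (1 + r) - ln r)"
    using r L L0 by (intro mult_mono) auto
  also have "ln 4 + ln (1 + r) = ln (4 * (1 + r))"
    using r by (subst ln_mult) auto
  finally have "2 * r * (25 / 6 + ln (1 / (3 * r)) / 2) \<le> 2 * r * ((2 + r) * (ln (4 * (1 + r)) - ln r))"
    using r by (intro mult_left_mono) auto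
  then show ?thesis by (simp only: mult_ac)
qed

section \<open>Bounds for the Wirtinger derivatives of a solution\<close>

lemma poisson_derivative_bounds:
  assumes p: "poisson_on (ball 0 1) f P Q g" and cont: "continuous_on (cball 0 1) f"
    and M1: "\<And>w. w \<in> ball 0 1 \<Longrightarrow> cmod (g w) \<le> M1"
    and M2: "\<And>w. w \<in> sphere 0 1 \<Longrightarrow> cmod (f w) \<le> M2"
  shows "cmod (P 0) + cmod (Q 0) \<le> 4 / pi * M2 + 2 / 3 * M1"
    and "z \<noteq> 0 \<Longrightarrow> cmod z \<le> 1 / 3 \<Longrightarrow> cmod (P z - P 0) + cmod (Q z - Q 0)
       \<le> 4 * M2 / pi * (cmod z * (2 - cmod z) / (1 - cmod z)\<^sup>2)
         + M1 * (2 * (ln (4 * (1 + cmod z)) - ln (cmod z)) * (2 + cmod z) * cmod z)"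
proof -
  have decomp: "\<exists>A B. (\<forall>z\<in>sphere 0 1. cmod (poly A z + cnj (poly B z)) \<le> M2 + \<epsilon>) \<and>
      green_part (\<lambda>z. f z - (poly A z + cnj (poly B z))) (\<lambda>z. P z - poly (pderiv A) z)
        (\<lambda>z. Q z - cnj (poly (pderiv B) z)) g M1 \<epsilon>"
    if \<epsilon>: "\<epsilon> > 0" for \<epsilon>
  proof -
    obtain A B where AB: "\<And>z. z \<in> sphere 0 1 \<Longrightarrow> cmod (f z - (poly A z + cnj (poly B z))) < \<epsilon>"
      using harmonic_poly_approx_on_circle[of f \<epsilon>] \<epsilon> continuous_on_subset[OF cont] by auto
    have "cmod (poly A z + cnj (poly B z)) \<le> M2 + \<epsilon>" if "z \<in> sphere 0 1" for z
      using AB[OF that] M2[OF that] norm_triangle_ineq4[of "f z" "f z - (poly A z + cnj (poly B z))"] by simp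
    moreover have "green_part (\<lambda>z. f z - (poly A z + cnj (poly B z))) (\<lambda>z. P z - poly (pderiv A) z)
        (\<lambda>z. Q z - cnj (poly (pderiv B) z)) g M1 \<epsilon>"
    proof
      show pv: "poisson_on (ball 0 1) (\<lambda>z. f z - (poly A z + cnj (poly B z))) (\<lambda>z. P z - poly (pderiv A) z)
        (\<lambda>z. Q z - cnj (poly (pderiv B) z)) g"
        by (rule poisson_on_diff_harmonic_poly[OF p])
      fix w :: complex assume w: "w \<in> ball 0 1"
      show "cmod (g w) \<le> M1" using M1[OF w] .
      show "cmod (f w - (poly A w + cnj (poly B w))) \<le> \<epsilon> + M1 * (1 - (cmod w)\<^sup>2) / 4"
        using w AB by (intro poisson_max_principle[OF pv _ M1] continuous_intros cont) (auto intro: less_imp_le)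
    qed
    ultimately show ?thesis by blast
  qed
  \<comment> \<open>Of the error, \<open>4 / pi * \<epsilon>\<close> stems from the harmonic
    polynomial and \<open>\<epsilon>\<close> from each of the two derivatives of the
    remainder.\<close>
  have perturbed: "cmod (P 0) + cmod (Q 0) \<le> 4 / pi * M2 + 2 / 3 * M1 + (4 / pi + 2) * \<epsilon>" if \<epsilon>: "\<epsilon> > 0" for \<epsilon>
  proof -
    obtain A B where AB: "\<And>z. z \<in> sphere 0 1 \<Longrightarrow> cmod (poly A z + cnj (poly B z)) \<le> M2 + \<epsilon>"
      and G: "green_part (\<lambda>z. f z - (poly A z + cnj (poly B z))) (\<lambda>z. P z - poly (pderiv A) z)
        (\<lambda>z. Q z - cnj (poly (pderiv B) z)) g M1 \<epsilon>"
      using decomp[OF \<epsilon>] by blast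
    define K where "K = 4 * (M2 + \<epsilon>) / pi"
    have "cmod (coeff A 1) + cmod (coeff B 1) \<le> K"
      unfolding K_def using harmonic_poly_coeff_bound[OF AB] by simp
    moreover have "cmod (P 0 - coeff A 1) \<le> \<epsilon> + M1 / 3"
      using green_part.norm_P_0[OF G] by (simp add: poly_0_coeff_0 coeff_pderiv)
    moreover have "cmod (cnj (Q 0 - cnj (coeff B 1))) \<le> \<epsilon> + M1 / 3"
      using green_part.norm_P_0[OF green_part_cnj[OF G]] by (simp add: poly_0_coeff_0 coeff_pderiv)
    moreover have "cmod (P 0) \<le> cmod (P 0 - coeff A 1) + cmod (coeff A 1)"
      using norm_triangle_sub[of "P 0" "coeff A 1"] by simp
    moreover have "cmod (Q 0) \<le> cmod (Q 0 - cnj (coeff B 1)) + cmod (coeff B 1)"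
      using norm_triangle_sub[of "Q 0" "cnj (coeff B 1)"] by simp
    ultimately have "cmod (P 0) + cmod (Q 0) \<le> K + 2 * (\<epsilon> + M1 / 3)"
      unfolding complex_mod_cnj by argo
    then show ?thesis unfolding K_def by (simp add: algebra_simps add_divide_distrib)
  qed
  have "cmod (P 0) + cmod (Q 0) \<le> 4 / pi * M2 + 2 / 3 * M1 + e" if "e > 0" for e
  proof -
    have "0 < 4 / pi + 2" by (simp add: add_pos_pos)
    then show ?thesis using that perturbed[of "e / (4 / pi + 2)"] by simp
  qed
  then show "cmod (P 0) + cmod (Q 0) \<le> 4 / pi * M2 + 2 / 3 * M1"
    by (rule field_le_epsilon)
  assume z: "z \<noteq> 0" "cmod z \<le> 1 / 3"
  define r where "r = cmod z"
  have r: "0 < r" "r \<le> 1 / 3" using z by (auto simp: r_def)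
  define c where "c = r * (2 - r) / (1 - r)\<^sup>2"
  define \<kappa> where "\<kappa> = 25 / 6 + ln (1 / (3 * r)) / 2"
  have c: "0 \<le> c" using r by (simp add: c_def)
  \<comment> \<open>At fixed \<open>z\<close> the error is a fixed multiple of
    \<open>\<epsilon>\<close>, so it can be removed as before; \<open>24 * r\<close> collects
    \<open>12 * r\<close> from each derivative of the remainder.\<close>
  have perturbed: "cmod (P z - P 0) + cmod (Q z - Q 0) \<le> 4 * M2 / pi * c + M1 * (2 * r * \<kappa>) + (4 / pi * c + 24 * r) * \<epsilon>"
    if \<epsilon>: "\<epsilon> > 0" for \<epsilon>
  proof -
    obtain A B where AB: "\<And>z. z \<in> sphere 0 1 \<Longrightarrow> cmod (poly A z + cnj (poly B z)) \<le> M2 + \<epsilon>"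
      and G: "green_part (\<lambda>z. f z - (poly A z + cnj (poly B z))) (\<lambda>z. P z - poly (pderiv A) z)
        (\<lambda>z. Q z - cnj (poly (pderiv B) z)) g M1 \<epsilon>"
      using decomp[OF \<epsilon>] by blast
    let ?A = "poly (pderiv A)" and ?B = "poly (pderiv B)"
    have "cmod (?A z - ?A 0) + cmod (?B z - ?B 0) \<le> 4 * (M2 + \<epsilon>) / pi * c"
      using harmonic_poly_deriv_diff[OF AB, of z] r by (simp add: c_def r_def)
    moreover have "cmod ((P z - ?A z) - (P 0 - ?A 0)) \<le> r * (M1 * \<kappa> + 12 * \<epsilon>)"
      using green_part.norm_P_diff[OF G z] by (simp add: r_def \<kappa>_def)
    moreover have "cmod (cnj ((Q z - cnj (?B z)) - (Q 0 - cnj (?B 0)))) \<le> r * (M1 * \<kappa> + 12 * \<epsilon>)"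
      using green_part.norm_P_diff[OF green_part_cnj[OF G] z] by (simp add: r_def \<kappa>_def)
    moreover have "cmod (P z - P 0) \<le> cmod ((P z - ?A z) - (P 0 - ?A 0)) + cmod (?A z - ?A 0)"
      using norm_triangle_ineq[of "(P z - ?A z) - (P 0 - ?A 0)" "?A z - ?A 0"] by simp
    moreover have "cmod (Q z - Q 0) \<le> cmod ((Q z - cnj (?B z)) - (Q 0 - cnj (?B 0))) + cmod (?B z - ?B 0)"
      using norm_triangle_ineq[of "(Q z - cnj (?B z)) - (Q 0 - cnj (?B 0))" "cnj (?B z - ?B 0)"]
      unfolding complex_mod_cnj by simp
    ultimately have "cmod (P z - P 0) + cmod (Q z - Q 0) \<le> 4 * (M2 + \<epsilon>) / pi * c + 2 * (r * (M1 * \<kappa> + 12 * \<epsilon>))"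
      unfolding complex_mod_cnj by linarith
    then show ?thesis by (simp add: algebra_simps add_divide_distrib)
  qed
  have "cmod (P z - P 0) + cmod (Q z - Q 0) \<le> 4 * M2 / pi * c + M1 * (2 * r * \<kappa>) + e" if "e > 0" for e
  proof -
    have "0 < 4 / pi * c + 24 * r" using c r by (simp add: add_nonneg_pos)
    then show ?thesis using that perturbed[of "e / (4 / pi * c + 24 * r)"] by simp
  qed
  then have "cmod (P z - P 0) + cmod (Q z - Q 0) \<le> 4 * M2 / pi * c + M1 * (2 * r * \<kappa>)"
    by (rule field_le_epsilon)
  also have "M1 * (2 * r * \<kappa>) \<le> M1 * (2 * (ln (4 * (1 + r)) - ln r) * (2 + r) * r)"
    using green_modulus_le_log_term[OF r] order_trans[OF norm_ge_zero M1[of 0]]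
    unfolding \<kappa>_def by (intro mult_left_mono) auto
  finally show "cmod (P z - P 0) + cmod (Q z - Q 0)
       \<le> 4 * M2 / pi * (cmod z * (2 - cmod z) / (1 - cmod z)\<^sup>2)
         + M1 * (2 * (ln (4 * (1 + cmod z)) - ln (cmod z)) * (2 + cmod z) * cmod z)"
    unfolding c_def r_def by simp
qed


section \<open>Univalence and univalent disks\<close>

text \<open>By invariance of domain the image is open, so its frontier lies in the image of the
  circle, where \<open>f\<close> has modulus at least \<open>R\<close>. The connected disk of radius
  \<open>R\<close> contains \<open>f 0 = 0\<close> and thus cannot leave the image.\<close>

lemma contains_univalent_disk_of_boundary_bound:
  assumes cont: "continuous_on (cball 0 r) f" and inj: "inj_on f (ball 0 r)" and f0: "f 0 = 0"
    and r: "0 < r" and R: "0 < R" and bd: "\<And>z. z \<in> sphere 0 r \<Longrightarrow> R \<le> cmod (f z)"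
  shows "contains_univalent_disk f r R"
proof -
  have contb: "continuous_on (ball 0 r) f"
    using cont continuous_on_subset ball_subset_cball by blast
  have opn: "open (f ` ball 0 r)"
    by (rule invariance_of_domain[OF contb _ inj]) simp
  have sub: "ball 0 R \<subseteq> f ` ball 0 r"
  proof (rule ccontr)
    assume "\<not> ball 0 R \<subseteq> f ` ball 0 r"
    then have "ball 0 R - f ` ball 0 r \<noteq> {}" by blast
    moreover have "0 \<in> ball 0 R \<inter> f ` ball 0 r"
      using R r f0 by force
    then have "ball 0 R \<inter> f ` ball 0 r \<noteq> {}" by blast
    ultimately obtain y where y: "y \<in> ball 0 R" "y \<in> frontier (f ` ball 0 r)"
      using connected_Int_frontier[of "ball 0 R" "f ` ball 0 r"] by auto
    have "closure (f ` ball 0 r) \<subseteq> f ` cball 0 r"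
      using compact_continuous_image[OF cont compact_cball]
      by (intro closure_minimal image_mono compact_imp_closed) auto
    then obtain z where z: "z \<in> cball 0 r" "y = f z" "y \<notin> f ` ball 0 r"
      using y(2) opn by (auto simp: frontier_def interior_open)
    then have "z \<in> sphere 0 r" by (auto simp: order_less_le)
    from bd[OF this] z y show False by simp
  qed
  define \<Omega> where "\<Omega> = ball 0 r \<inter> f -` ball 0 R"
  have "open \<Omega>"
    unfolding \<Omega>_def by (rule continuous_open_preimage[OF contb]) auto
  moreover have "bij_betw f \<Omega> (ball 0 R)"
    using sub inj by (auto simp: bij_betw_def \<Omega>_def inj_on_def)
  \<comment> \<open>\<open>\<Omega>\<close> is the image of the disk under the continuous inverse of
    \<open>f\<close>.\<close>
  moreover have "connected \<Omega>"
  proof -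
    obtain g where g: "homeomorphism (ball 0 r) (f ` ball 0 r) f g"
      using invariance_of_domain_homeomorphism[OF _ contb _ inj] by auto
    have "\<Omega> = g ` ball 0 R"
    proof (intro equalityI subsetI)
      fix x assume "x \<in> \<Omega>"
      then show "x \<in> g ` ball 0 R"
        using homeomorphism_apply1[OF g, of x] by (intro image_eqI[of _ _ "f x"]) (auto simp: \<Omega>_def)
    next
      fix x assume "x \<in> g ` ball 0 R"
      then obtain y where y: "y \<in> ball 0 R" "x = g y" by auto
      then have "y \<in> f ` ball 0 r" using sub by blast
      then have "f (g y) = y" "g y \<in> ball 0 r"
        using homeomorphism_apply2[OF g] homeomorphism_image2[OF g] by blast+
      then show "x \<in> \<Omega>" using y by (simp add: \<Omega>_def)
    qed
    moreover have "continuous_on (ball 0 R) g"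
      using homeomorphism_cont2[OF g] sub continuous_on_subset by blast
    ultimately show ?thesis using connected_continuous_image by auto
  qed
  moreover have "0 \<in> \<Omega>" "\<Omega> \<subseteq> ball 0 r"
    using f0 r R by (simp_all add: \<Omega>_def)
  ultimately show ?thesis
    using sub unfolding contains_univalent_disk_def by blast
qed

text \<open>\<open>K\<close> is only monotone, but the other term is \<open>|z|\<close> times an increasing function; this yields the factor 1/2
  in the boundary bound.\<close>

lemma landau_radius:
  fixes X r0 :: real and K :: "real \<Rightarrow> real"
  assumes w: "wirtinger_on (ball 0 1) f P Q" and f0: "f 0 = 0" and X: "X > 0" and r0: "0 < r0" "r0 < 1"
    and K0: "\<And>r. 0 < r \<Longrightarrow> 0 \<le> K r" and Kmono: "\<And>s t. 0 < s \<Longrightarrow> s \<le> t \<Longrightarrow> K s \<le> K t"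
    and dev: "\<And>z. z \<noteq> 0 \<Longrightarrow> cmod z \<le> r0 \<Longrightarrow> cmod (P z - P 0) + cmod (Q z - Q 0)
       \<le> X * (cmod z * (2 - cmod z) / (1 - cmod z)\<^sup>2) + K (cmod z)"
    and low: "X * (r0 * (2 - r0) / (1 - r0)\<^sup>2) + K r0 \<le> cmod (P 0) - cmod (Q 0)"
  shows "inj_on f (ball 0 r0)"
    and "z \<in> sphere 0 r0 \<Longrightarrow> X * (r0\<^sup>2 * (2 - r0) / (1 - r0)\<^sup>2) / 2 \<le> cmod (f z)"
proof -
  define e where "e s = (2 - s) / (1 - s)\<^sup>2" for s :: real
  have e: "e s = 1 / (1 - s) + 1 / (1 - s)\<^sup>2" if "s < 1" for s
  proof -
    have "1 / (1 - s) = (1 - s) / (1 - s)\<^sup>2" using that by (simp add: power2_eq_square)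
    then show ?thesis by (simp add: e_def flip: add_divide_distrib)
  qed
  have emono: "e s \<le> e t" if "s \<le> t" "t < 1" for s t
    unfolding e[OF that(2)] e[OF le_less_trans[OF that]] using that
    by (intro add_mono divide_left_mono power_mono mult_pos_pos zero_less_power) auto
  have epos: "0 < e s" if "s < 1" for s
    using that by (simp add: e_def)
  \<comment> \<open>\<open>e\<close> and \<open>K\<close> are frozen at \<open>r\<close>, while the
    linear factor \<open>s\<close> is kept. The case \<open>s = r\<close> serves injectivity, the
    case \<open>s = t * r0\<close> with \<open>r = r0\<close> the boundary bound.\<close>
  have dev': "cmod (P z - P 0) + cmod (Q z - Q 0) \<le> X * (s * e r) + K r"
    if "cmod z \<le> s" "s \<le> r" "0 < r" "r \<le> r0" for z s r
  proof (cases "z = 0")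
    case True
    then show ?thesis using that X K0[of r] epos[of r] r0 by simp
  next
    case False
    have "cmod z * e (cmod z) \<le> s * e r"
      using that r0 epos[of "cmod z"] order_trans[OF norm_ge_zero that(1)] by (intro mult_mono emono) auto
    then have "X * (cmod z * e (cmod z)) + K (cmod z) \<le> X * (s * e r) + K r"
      using that False X Kmono[of "cmod z" r] by (intro add_mono mult_left_mono) auto
    with dev[OF False] that show ?thesis by (simp add: e_def)
  qed
  \<comment> \<open>\<open>L\<close> is the derivative of \<open>f\<close> at 0 and expands lengths
    at least by \<open>cmod (P 0) - cmod (Q 0)\<close>; \<open>F = f - L\<close> is the
    perturbation.\<close>
  define L where "L h = P 0 * h + Q 0 * cnj h" for h
  have L: "(cmod (P 0) - cmod (Q 0)) * cmod h \<le> cmod (L h)" for h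
    using norm_diff_ineq[of "P 0 * h" "Q 0 * cnj h"] by (simp add: L_def norm_mult algebra_simps)
  have Ldiff: "L (x - y) = L x - L y" for x y by (simp add: L_def algebra_simps)
  define F where "F x = f x - L x" for x
  have wF: "wirtinger_on (ball 0 1) F (\<lambda>z. P z - P 0) (\<lambda>z. Q z - Q 0)"
    unfolding F_def L_def
    by (rule wirtinger_on_diff[OF w]) (auto simp: wirtinger_on_def intro!: derivative_eq_intros continuous_intros)
  have dbound: "cmod ((P x - P 0) * h + (Q x - Q 0) * cnj h) \<le> (cmod (P x - P 0) + cmod (Q x - Q 0)) * cmod h" for x h
    by (rule order_trans[OF norm_triangle_ineq]) (simp add: norm_mult distrib_right)
  show "inj_on f (ball 0 r0)"
  proof (rule inj_onI, rule ccontr)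
    fix x y assume xy: "x \<in> ball 0 r0" "y \<in> ball 0 r0" "f x = f y" "x \<noteq> y"
    \<comment> \<open>A radius strictly below \<open>r0\<close> makes the Lipschitz constant of
      \<open>F\<close> strictly smaller than the expansion of \<open>L\<close>.\<close>
    define r where "r = max (cmod x) (cmod y)"
    have r: "0 < r" "r < r0" using xy by (auto simp: r_def less_max_iff_disj)
    let ?B = "X * (r * e r) + K r"
    have "cmod (F x - F y) \<le> ?B * cmod (x - y)"
    proof (rule differentiable_bound[of "cball 0 r"])
      fix u assume u: "u \<in> cball (0 :: complex) r"
      then show "(F has_derivative (\<lambda>h. (P u - P 0) * h + (Q u - Q 0) * cnj h)) (at u within cball 0 r)"
        using r r0 by (intro has_derivative_at_withinI[OF wirtinger_onD(1)[OF wF]]) auto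
      have "cmod (P u - P 0) + cmod (Q u - Q 0) \<le> ?B" using dev'[of u r r] u r by auto
      then show "onorm (\<lambda>h. (P u - P 0) * h + (Q u - Q 0) * cnj h) \<le> ?B"
        by (intro onorm_le order_trans[OF dbound] mult_right_mono) auto
    qed (auto simp: r_def)
    moreover have "cmod (F x - F y) = cmod (L (x - y))"
      using xy(3) by (simp add: F_def Ldiff norm_minus_commute)
    ultimately have "(cmod (P 0) - cmod (Q 0)) * cmod (x - y) \<le> ?B * cmod (x - y)"
      using L[of "x - y"] by simp
    then have "cmod (P 0) - cmod (Q 0) \<le> ?B" using xy(4) by simp
    moreover have "?B < X * (r0 * e r0) + K r0"
    proof -
      have "r * e r < r0 * e r0"
      proof -
        have "r * e r \<le> r * e r0" using r r0 by (intro mult_left_mono emono) auto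
        also have "\<dots> < r0 * e r0" using r epos[OF r0(2)] by simp
        finally show ?thesis .
      qed
      then show ?thesis using X Kmono[of r r0] r by (intro add_less_le_mono mult_strict_left_mono) auto
    qed
    ultimately show False using low by (simp add: e_def)
  qed
  assume z: "z \<in> sphere 0 r0"
  have inb: "of_real t * z \<in> ball 0 1" "cmod (of_real t * z) = t * r0" if "0 \<le> t" "t \<le> 1" for t
  proof -
    show "cmod (of_real t * z) = t * r0" using that z by (simp add: norm_mult)
    moreover have "t * r0 < 1"
      by (rule le_less_trans[OF mult_left_le_one_le r0(2)]) (use that r0 in auto)
    ultimately show "of_real t * z \<in> ball 0 1" by simp
  qed
  \<comment> \<open>Along the ray the derivative of \<open>F\<close> is bounded by an affine
    function of \<open>t\<close>; integration halves its linear part, which carries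
    \<open>X\<close>, and keeps \<open>K r0\<close> whole.\<close>
  have "cmod (F (of_real 1 * z) - F (of_real 0 * z)) \<le> r0 * (X * (r0 * e r0) * 1\<^sup>2 / 2 + K r0 * 1) - r0 * (X * (r0 * e r0) * 0\<^sup>2 / 2 + K r0 * 0)"
  proof (rule differentiable_bound_general[where
        f' = "\<lambda>t. (P (of_real t * z) - P 0) * z + (Q (of_real t * z) - Q 0) * cnj z"
        and \<phi>' = "\<lambda>t. r0 * (X * (r0 * e r0) * t + K r0)"])
    show "continuous_on {0..1} (\<lambda>t. F (of_real t * z))"
      using inb by (intro continuous_on_compose2[OF wirtinger_on_continuous[OF wF]] continuous_intros) auto
  next
    fix t :: real assume t: "0 < t" "t < 1"
    have "((\<lambda>t. of_real t * z) has_vector_derivative z) (at t)"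
      by (auto intro!: derivative_eq_intros simp: has_vector_derivative_def scaleR_conv_of_real)
    with inb[of t] t
    show "((\<lambda>t. F (of_real t * z)) has_vector_derivative
        (P (of_real t * z) - P 0) * z + (Q (of_real t * z) - Q 0) * cnj z) (at t)"
      by (intro wirtinger_on_curve[OF wF]) auto
    show "((\<lambda>t. r0 * (X * (r0 * e r0) * t\<^sup>2 / 2 + K r0 * t)) has_vector_derivative r0 * (X * (r0 * e r0) * t + K r0)) (at t)"
      unfolding has_real_derivative_iff_has_vector_derivative[symmetric]
      by (auto intro!: derivative_eq_intros)
    have "cmod (P (of_real t * z) - P 0) + cmod (Q (of_real t * z) - Q 0) \<le> X * (t * r0 * e r0) + K r0"
      using inb[of t] t r0 mult_left_le_one_le[of r0 t] by (intro dev') auto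
    then have "(cmod (P (of_real t * z) - P 0) + cmod (Q (of_real t * z) - Q 0)) * cmod z \<le> (X * (t * r0 * e r0) + K r0) * r0"
      using mult_right_mono[OF _ less_imp_le[OF r0(1)]] z by simp
    then show "cmod ((P (of_real t * z) - P 0) * z + (Q (of_real t * z) - Q 0) * cnj z) \<le> r0 * (X * (r0 * e r0) * t + K r0)"
      using dbound[of "of_real t * z" z] by (simp add: mult_ac)
  qed (auto intro!: continuous_intros)
  moreover have "F 0 = 0" by (simp add: F_def L_def f0)
  ultimately have "cmod (F z) \<le> r0 * (X * (r0 * e r0) / 2 + K r0)" by simp
  moreover have "(X * (r0 * e r0) + K r0) * r0 \<le> (cmod (P 0) - cmod (Q 0)) * cmod z"
    using mult_right_mono[OF low less_imp_le[OF r0(1)]] z by (simp add: e_def)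
  moreover have "cmod (L z) \<le> cmod (f z) + cmod (F z)"
    using norm_triangle_ineq4[of "f z" "F z"] by (simp add: F_def)
  ultimately have "r0 * (X * (r0 * e r0)) / 2 \<le> cmod (f z)"
    using L[of z] by (simp add: algebra_simps)
  then show "X * (r0\<^sup>2 * (2 - r0) / (1 - r0)\<^sup>2) / 2 \<le> cmod (f z)"
    by (simp add: e_def power2_eq_square mult_ac)
qed

text \<open>Compactness of the closed disk makes the values bounded, so the supremum is a genuine
  upper bound.\<close>

lemma norm_le_disk_sup_norm:
  assumes "continuous_on (cball 0 1) h" "w \<in> ball 0 1"
  shows "cmod (h w) \<le> disk_sup_norm h"
  unfolding disk_sup_norm_def
proof (rule cSUP_upper[OF assms(2)])
  have "bounded (h ` cball 0 1)"
    using assms(1) by (intro compact_imp_bounded compact_continuous_image) auto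
  then obtain B where "\<forall>z\<in>cball 0 1. cmod (h z) \<le> B"
    by (auto simp: bounded_iff)
  then show "bdd_above ((\<lambda>z. cmod (h z)) ` ball 0 1)"
    by (intro bdd_aboveI[of _ B]) auto
qed

theorem theorem4:
  fixes f g :: "complex \<Rightarrow> complex" and M1 M2 r0 :: real
  assumes "M1 \<ge> 0" and "M2 > 0"
    and "continuous_on (cball 0 1) g" and "disk_sup_norm g \<le> M1"
    and "f \<in> poisson_class g" and "disk_sup_norm f \<le> M2"
    and "0 < r0" and "r0 < 1"
    and "1 / (4 / pi * M2 + 2 / 3 * M1)
           - 4 * M2 / pi * (r0 * (2 - r0) / (1 - r0)\<^sup>2)
           - 2 * M1 * (ln (4 * (1 + r0)) - ln r0) * (2 + r0) * r0 = 0"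
  shows "inj_on f (ball 0 r0) \<and>
    (\<exists>R0. R0 \<ge> 2 * M2 / pi * (r0\<^sup>2 * (2 - r0) / (1 - r0)\<^sup>2) \<and> contains_univalent_disk f r0 R0)"
proof -
  have cont: "continuous_on (cball 0 1) f" and C2: "C2_on (ball 0 1) f"
    and lap: "\<And>z. z \<in> ball 0 1 \<Longrightarrow> laplacian f z = g z" and f0: "f 0 = 0" and jac: "jacobian f 0 = 1"
    using assms(5) by (auto simp: poisson_class_def)
  have g_le: "cmod (g w) \<le> M1" if "w \<in> ball 0 1" for w
    using norm_le_disk_sup_norm[OF assms(3) that] assms(4) by simp
  \<comment> \<open>The norm is a supremum over the open disk; continuity carries the bound to the
    circle.\<close>
  have f_le: "cmod (f w) \<le> M2" if "w \<in> sphere 0 1" for w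
  proof (rule continuous_on_closure_norm_le[of "ball 0 1" f])
    show "\<forall>w\<in>ball 0 1. cmod (f w) \<le> M2"
      by (intro ballI order_trans[OF norm_le_disk_sup_norm[OF cont] assms(6)])
  qed (use cont that in auto)
  define P Q where "P = wirtinger_z f" and "Q = wirtinger_zbar f"
  have pois: "poisson_on (ball 0 1) f P Q g"
    unfolding P_def Q_def using C2_on_poisson[OF open_ball C2 lap] .
  define X where "X = 4 * M2 / pi"
  define D where "D = 4 / pi * M2 + 2 / 3 * M1"
  define K where "K r = M1 * (2 * (ln (4 * (1 + r)) - ln r) * (2 + r) * r)" for r
  define c where "c = r0 * (2 - r0) / (1 - r0)\<^sup>2"
  have X: "X > 0" using assms(2) by (simp add: X_def)
  have D: "D = X + 2 / 3 * M1" by (simp add: D_def X_def)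
  have eqn: "1 / D = X * c + K r0"
    using assms(9) by (simp add: D_def X_def c_def K_def algebra_simps)
  have K0: "0 \<le> K r" if "0 < r" for r
    unfolding K_def using that assms(1) ln_4_mult_div_ge_1[OF that] by (intro mult_nonneg_nonneg) auto
  have Kmono: "K s \<le> K t" if "0 < s" "s \<le> t" for s t
    unfolding K_def by (rule mult_left_mono[OF log_term_mono[OF that] assms(1)])
  define a b where "a = cmod (P 0)" and "b = cmod (Q 0)"
  have jac': "(a - b) * (a + b) = 1"
    using jac by (simp add: jacobian_def a_def b_def P_def Q_def power2_eq_square algebra_simps)
  have ab: "a + b \<le> D" "0 \<le> a" "0 \<le> b"
    using poisson_derivative_bounds(1)[OF pois cont g_le f_le] by (simp_all add: a_def b_def D_def)
  \<comment> \<open>The Jacobian condition reads \<open>a\<^sup>2 = 1 + b\<^sup>2\<close>, so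
    \<open>1 \<le> a \<le> a + b \<le> D\<close>.\<close>
  have D1: "1 \<le> D"
  proof -
    have "1\<^sup>2 \<le> a\<^sup>2" using jac' ab by (simp add: power2_eq_square algebra_simps)
    then have "1 \<le> a" using ab(2) power2_le_imp_le by blast
    then show ?thesis using ab by simp
  qed
  \<comment> \<open>The smallest singular value at 0 is
    \<open>a - b = 1 / (a + b) \<ge> 1 / D\<close>, and \<open>1 / D\<close> is the other side of
    the equation for \<open>r0\<close>.\<close>
  have low: "X * c + K r0 \<le> a - b"
  proof -
    have "a + b \<noteq> 0" using jac' by auto
    then have "0 < a + b" using ab by simp
    then have "a - b = 1 / (a + b)" using jac' by (simp add: field_simps)
    also have "1 / (a + b) \<ge> 1 / D" using ab \<open>0 < a + b\<close> by (intro divide_left_mono) auto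
    finally show ?thesis using eqn by simp
  qed
  \<comment> \<open>Beyond \<open>1 / 3\<close>, \<open>c\<close> is at least \<open>5 / 4\<close>,
    its value at \<open>1 / 3\<close>, and \<open>K r0\<close> is at least
    \<open>4 / 3 * M1\<close>, more than enough for \<open>5 / 4\<close> of the summand
    \<open>2 / 3 * M1\<close> in \<open>D\<close>. The equation would give
    \<open>5 / 4 * D \<le> 1 / D\<close>, against \<open>D \<ge> 1\<close>.\<close>
  have r13: "r0 \<le> 1 / 3"
  proof (rule ccontr)
    assume "\<not> r0 \<le> 1 / 3"
    then have r: "1 / 3 < r0" by simp
    have "(1 - r0)\<^sup>2 \<le> (2 / 3)\<^sup>2" using r assms(8) by (intro power_mono) auto
    moreover have "(2 / 3 :: real)\<^sup>2 = 4 / 9" by (simp add: power2_eq_square)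
    moreover have "r0 * (2 - r0) = 1 - (1 - r0)\<^sup>2" by (simp add: power2_eq_square algebra_simps)
    ultimately have "5 / 4 * (1 - r0)\<^sup>2 \<le> r0 * (2 - r0)"
      by linarith
    then have c: "5 / 4 \<le> c" using assms(8) by (simp add: c_def field_simps)
    have "4 / 3 \<le> 2 * 1 * 2 * (1 / 3 :: real)" by simp
    also have "\<dots> \<le> 2 * (ln (4 * (1 + r0)) - ln r0) * (2 + r0) * r0"
      using ln_4_mult_div_ge_1[OF assms(7)] r by (intro mult_mono) auto
    finally have "M1 * (4 / 3) \<le> K r0" unfolding K_def by (rule mult_left_mono[OF _ assms(1)])
    moreover have "X * (5 / 4) \<le> X * c" using c X by (intro mult_left_mono) auto
    ultimately have "5 / 4 * D \<le> 1 / D" unfolding eqn using D assms(1) by simp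
    moreover have "1 / D \<le> 1" using D1 by simp
    ultimately show False using D1 by simp
  qed
  have w: "wirtinger_on (ball 0 1) f P Q" using pois by (simp add: poisson_on_def)
  have dev: "cmod (P z - P 0) + cmod (Q z - Q 0) \<le> X * (cmod z * (2 - cmod z) / (1 - cmod z)\<^sup>2) + K (cmod z)"
    if "z \<noteq> 0" "cmod z \<le> r0" for z
    using poisson_derivative_bounds(2)[OF pois cont g_le f_le that(1)] that(2) r13
    by (simp add: X_def K_def)
  note landau = landau_radius[OF w f0 X assms(7,8) K0 Kmono dev low[unfolded c_def a_def b_def]]
  \<comment> \<open>The witness is the claimed lower bound itself, since
    \<open>X / 2 = 2 * M2 / pi\<close>.\<close>
  let ?R = "X * (r0\<^sup>2 * (2 - r0) / (1 - r0)\<^sup>2) / 2"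
  have "contains_univalent_disk f r0 ?R"
  proof (rule contains_univalent_disk_of_boundary_bound)
    show "continuous_on (cball 0 r0) f"
      using cont assms(8) by (auto intro: continuous_on_subset)
    show "0 < ?R" using X assms(7,8) by simp
  qed (use landau f0 assms(7) in auto)
  moreover have "2 * M2 / pi * (r0\<^sup>2 * (2 - r0) / (1 - r0)\<^sup>2) = ?R" by (simp add: X_def)
  ultimately show ?thesis using landau(1) by auto
qed

end
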